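(* Assume that the vocal-tract radius $r(x)$ belongs to the class $\mathcal{A}$ on $[0,\ell]$. Then, for $k\in\mathbf{C}$ the solution $P(k,x)$ to the Webster horn equation $$[r(x)^2P'(k,x)]'+k^2r(x)^2P(k,x)=0,\qquad x\in(0,\ell),$$ satisfying the boundary conditions $$P'(k,0)=-\frac{ikc\mu}{\pi r_0^2},\qquad P'(k,\ell)+\frac{ik}{z(k)}P(k,\ell)=0$$ exists, is unique, and is given by $$P(k,x)=-\frac{ikc\mu}{\pi r_0\,r(x)}\left[\frac{g(k,0)}{G(k)}\,\varphi(k,x)+S(k,x)\right],\qquad x\in[0,\ell].$$
   Context: Here $\ell>0$ is a fixed constant. Class $\mathcal{A}$: $r(x)$ is real valued and positive for $x\in[0,\ell]$, the derivative $r'$ is continuous on $[0,\ell]$, and the second derivative $r''$ is integrable on $(0,\ell)$. Notation: prime is $d/dx$, $r_0=r(0)$, $r_\ell=r(\ell)$, $r_0'=r'(0)$, $r_\ell'=r'(\ell)$. The positive constants $c$ (sound speed) and $\mu$ (air density) are fixed. Normalized impedance: $z(k)=1-\dfrac{J_1(2kr_\ell)}{kr_\ell}+i\,\dfrac{\mathbf{H}_1(2kr_\ell)}{kr_\ell}$, which is an entire function of $k$, where $J_1$ is the Bessel function and $\mathbf{H}_1$ the Struve function of order one. With $q(x)=r''(x)/r(x)$, consider the Schrödinger equation $-\psi''+q\psi=k^2\psi$ on $(0,\ell)$. Its solutions $S,\varphi,g$ are fixed by $S(k,0)=0$, $S'(k,0)=1$; $\varphi(k,0)=1$, $\varphi'(k,0)=r_0'/r_0$;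 $g(k,\ell)=z(k)$, $g'(k,\ell)=\dfrac{r_\ell'}{r_\ell}z(k)-ik$. Finally $G(k)=\varphi(k,x)g'(k,x)-\varphi'(k,x)g(k,x)$, which is independent of $x$.
   Formalization: Nonzero k with G(k)=0 are excluded, since no solution exists there; such k are shown to be isolated. At k=0 the coefficient ik/z(k) is read as its limit, and at other zeros of z the condition at ℓ is read as P(k,ℓ)=0. *)

theory Defs
  imports "HOL-Complex_Analysis.Complex_Analysis"
begin

section \<open>Functions on the interval from 0 to \<open>l\<close>\<close>

text \<open>Derivative relative to the closed interval, so one-sided at the two endpoints.\<close>

definition D :: "real \<Rightarrow> (real \<Rightarrow> 'a::euclidean_space) \<Rightarrow> real \<Rightarrow> 'a" where
  "D l f x = vector_derivative f (at x within {0..l})"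

text \<open>
  \<open>f\<close> is absolutely continuous on the closed interval and \<open>h\<close> is a representative of its
  Lebesgue integrable derivative, which is determined only almost everywhere.
\<close>

definition ac_deriv :: "real \<Rightarrow> (real \<Rightarrow> 'a::euclidean_space) \<Rightarrow> (real \<Rightarrow> 'a) \<Rightarrow> bool" where
  "ac_deriv l f h \<longleftrightarrow>
     h absolutely_integrable_on {0..l} \<and>
     (\<forall>x\<in>{0..l}. (h has_integral (f x - f 0)) {0..x})"

text \<open>The class \<open>\<A>\<close>; \<open>r2\<close> is a representative of the second derivative of \<open>r\<close>.\<close>

definition class_A :: "real \<Rightarrow> (real \<Rightarrow> real) \<Rightarrow> (real \<Rightarrow> real) \<Rightarrow> bool" where
  "class_A l r r2 \<longleftrightarrow>
     (\<forall>x\<in>{0..l}. r x > 0) \<and>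
     r differentiable_on {0..l} \<and>
     continuous_on {0..l} (D l r) \<and>
     ac_deriv l (D l r) r2"


section \<open>Bessel and Struve functions, normalized impedance\<close>

definition bessel_J :: "nat \<Rightarrow> complex \<Rightarrow> complex" where
  "bessel_J n w = (\<Sum>m. (-1) ^ m / (fact m * fact (m + n)) * (w / 2) ^ (2 * m + n))"

definition struve_H :: "nat \<Rightarrow> complex \<Rightarrow> complex" where
  "struve_H n w =
     (\<Sum>m. (-1) ^ m / (Gamma (of_nat m + 3 / 2) * Gamma (of_nat m + of_nat n + 3 / 2))
          * (w / 2) ^ (2 * m + n + 1))"

text \<open>
  \<open>rl\<close> is the radius at the lips. The singularity of the quotients at \<open>k = 0\<close> is removable;
  \<open>remove_sings\<close> makes the normalized impedance entire.
\<close>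

definition impedance :: "real \<Rightarrow> complex \<Rightarrow> complex" where
  "impedance rl = remove_sings (\<lambda>k.
     1 - bessel_J 1 (2 * k * of_real rl) / (k * of_real rl)
       + \<i> * (struve_H 1 (2 * k * of_real rl) / (k * of_real rl)))"


section \<open>The Schroedinger equation\<close>

definition schroedinger_solution ::
    "real \<Rightarrow> (real \<Rightarrow> real) \<Rightarrow> complex \<Rightarrow> (real \<Rightarrow> complex) \<Rightarrow> bool" where
  "schroedinger_solution l q k \<psi> \<longleftrightarrow>
     \<psi> differentiable_on {0..l} \<and>
     (\<exists>\<psi>2. ac_deriv l (D l \<psi>) \<psi>2 \<and>
           (AE x in lebesgue_on {0<..<l}. - \<psi>2 x + of_real (q x) * \<psi> x = k\<^sup>2 * \<psi> x))"

text \<open>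
  The solution with value \<open>a\<close> and derivative \<open>b\<close> at \<open>x0\<close>; it is unique on the closed interval,
  so the choice affects only the irrelevant values outside it.
\<close>

definition schroedinger_ivp ::
    "real \<Rightarrow> (real \<Rightarrow> real) \<Rightarrow> complex \<Rightarrow> real \<Rightarrow> complex \<Rightarrow> complex \<Rightarrow> real \<Rightarrow> complex" where
  "schroedinger_ivp l q k x0 a b =
     (SOME \<psi>. schroedinger_solution l q k \<psi> \<and> \<psi> x0 = a \<and> D l \<psi> x0 = b)"

definition potential :: "(real \<Rightarrow> real) \<Rightarrow> (real \<Rightarrow> real) \<Rightarrow> real \<Rightarrow> real" where
  "potential r r2 x = r2 x / r x"

definition sol_S :: "real \<Rightarrow> (real \<Rightarrow> real) \<Rightarrow> (real \<Rightarrow> real) \<Rightarrow> complex \<Rightarrow> real \<Rightarrow> complex" where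
  "sol_S l r r2 k = schroedinger_ivp l (potential r r2) k 0 0 1"

definition sol_phi :: "real \<Rightarrow> (real \<Rightarrow> real) \<Rightarrow> (real \<Rightarrow> real) \<Rightarrow> complex \<Rightarrow> real \<Rightarrow> complex" where
  "sol_phi l r r2 k = schroedinger_ivp l (potential r r2) k 0 1 (of_real (D l r 0 / r 0))"

definition sol_g :: "real \<Rightarrow> (real \<Rightarrow> real) \<Rightarrow> (real \<Rightarrow> real) \<Rightarrow> complex \<Rightarrow> real \<Rightarrow> complex" where
  "sol_g l r r2 k = schroedinger_ivp l (potential r r2) k l
     (impedance (r l) k)
     (of_real (D l r l / r l) * impedance (r l) k - \<i> * k)"

text \<open>The constant value of the Wronskian of \<open>sol_phi\<close> and \<open>sol_g\<close>.\<close>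

definition wronskian_G :: "real \<Rightarrow> (real \<Rightarrow> real) \<Rightarrow> (real \<Rightarrow> real) \<Rightarrow> complex \<Rightarrow> complex" where
  "wronskian_G l r r2 k =
     (THE w. \<forall>x\<in>{0..l}.
        w = sol_phi l r r2 k x * D l (sol_g l r r2 k) x
          - D l (sol_phi l r r2 k) x * sol_g l r r2 k x)"


section \<open>The boundary value problem for the pressure\<close>

text \<open>
  The condition at the lips, with \<open>p\<close> and \<open>dp\<close> the values of \<open>P\<close> and its derivative there.
  The coefficient \<open>i k / z(k)\<close> is meromorphic in \<open>k\<close>. Since \<open>z\<close> has a simple zero at \<open>k = 0\<close>,
  the coefficient has a removable singularity there and is given its limit (division by zero
  in HOL would give 0). At any other zero of \<open>z\<close> it is infinite, and the condition means
  that the pressure vanishes.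
\<close>

definition lip_condition :: "real \<Rightarrow> complex \<Rightarrow> complex \<Rightarrow> complex \<Rightarrow> bool" where
  "lip_condition rl k p dp \<longleftrightarrow>
     (if k = 0 then dp + Lim (at 0) (\<lambda>\<kappa>. \<i> * \<kappa> / impedance rl \<kappa>) * p = 0
      else if impedance rl k = 0 then p = 0
      else dp + \<i> * k / impedance rl k * p = 0)"

definition pressure_solution ::
    "real \<Rightarrow> (real \<Rightarrow> real) \<Rightarrow> real \<Rightarrow> real \<Rightarrow> complex \<Rightarrow> (real \<Rightarrow> complex) \<Rightarrow> bool" where
  "pressure_solution l r c \<mu> k P \<longleftrightarrow>
     P differentiable_on {0..l} \<and>
     (\<forall>x\<in>{0<..<l}. \<exists>d.
        ((\<lambda>y. of_real ((r y)\<^sup>2) * D l P y) has_vector_derivative d) (at x) \<and>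
        d + k\<^sup>2 * of_real ((r x)\<^sup>2) * P x = 0) \<and>
     D l P 0 = - (\<i> * k * of_real c * of_real \<mu> / (of_real pi * of_real ((r 0)\<^sup>2))) \<and>
     lip_condition (r l) k (P l) (D l P l)"

end

theory Submission
  imports Defs
begin

text \<open>
  Writing \<open>u = \<psi> / r\<close> and \<open>v = r \<psi>' - r' \<psi>\<close> turns the Schroedinger equation, whose potential is only
  integrable, into the system \<open>u' = v / r\<^sup>2\<close>, \<open>v' = - k\<^sup>2 r\<^sup>2 u\<close> with continuous coefficients, which is the
  Webster equation for \<open>u\<close>. The system is solved by power series in \<open>- k\<^sup>2\<close> whose coefficients are
  iterated integrals, so that values of solutions are entire in \<open>k\<close>; uniqueness follows from the
  constancy of the Wronskian \<open>u v\<^sub>1 - v u\<^sub>1\<close>. In these terms the condition at the lips says that the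
  Wronskian of \<open>P\<close> and \<open>g / r\<close> vanishes, which together with the value of \<open>P'\<close> at \<open>0\<close> determines \<open>P(0)\<close>
  provided that \<open>G(k) \<noteq> 0\<close>. Finally \<open>r\<^sub>0 G(k) = - i k r\<^sub>l u\<^sub>1(l) - v\<^sub>1(l) z(k) / r\<^sub>l\<close> for the solution with
  initial values \<open>(1, 0)\<close>; since \<open>z\<close> vanishes at \<open>0\<close>, the derivative of \<open>G\<close> there is \<open>- i r\<^sub>l / r\<^sub>0\<close>, so
  \<open>G\<close> is entire and not identically zero. At \<open>k = 0\<close> the simple zero of \<open>z\<close> makes the condition at the lips
  read \<open>P'(l) + \<alpha> P(l) = 0\<close> with \<open>\<alpha> \<noteq> 0\<close>, which only the zero solution satisfies.
\<close>

section \<open>Absolutely continuous functions\<close>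

text \<open>On a partition of \<open>{a..b}\<close> finer than \<open>\<delta>\<close> the
  increments telescope to \<open>norm (F b - F a) \<le> \<epsilon> * (\<Phi> b - \<Phi> a)\<close>,
  and \<open>\<epsilon>\<close> is arbitrary. This yields the product rule below without any
  differentiation almost everywhere.\<close>

lemma eq_of_dominated_increments:
  fixes F :: "real \<Rightarrow> 'a::real_normed_vector" and \<Phi> :: "real \<Rightarrow> real"
  assumes "a \<le> b"
    and small: "\<And>\<epsilon>. \<epsilon> > 0 \<Longrightarrow> \<exists>\<delta>>0. \<forall>x\<in>{a..b}. \<forall>y\<in>{a..b}. x \<le> y \<longrightarrow> y - x < \<delta> \<longrightarrow>
                  norm (F y - F x) \<le> \<epsilon> * (\<Phi> y - \<Phi> x)"
  shows "F b = F a"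
proof -
  have bound: "norm (F b - F a) \<le> \<epsilon> * (\<Phi> b - \<Phi> a)" if eps: "\<epsilon> > 0" for \<epsilon>
  proof -
    obtain \<delta> where "\<delta> > 0" and \<delta>: "\<And>x y. x \<in> {a..b} \<Longrightarrow> y \<in> {a..b} \<Longrightarrow> x \<le> y \<Longrightarrow> y - x < \<delta> \<Longrightarrow>
        norm (F y - F x) \<le> \<epsilon> * (\<Phi> y - \<Phi> x)"
      using small[OF eps] by blast
    obtain n :: nat where n: "(b - a) / \<delta> < real n"
      using reals_Archimedean2 by blast
    have "n > 0"
      using n \<open>a \<le> b\<close> \<open>\<delta> > 0\<close> by (cases n) (auto simp: field_simps)
    define p where "p i = a + (b - a) * (real i / real n)" for i
    have p_mem: "p i \<in> {a..b}" if "i \<le> n" for i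
    proof -
      have "(b - a) * (real i / real n) \<le> (b - a) * 1"
        using that \<open>n > 0\<close> \<open>a \<le> b\<close> by (intro mult_left_mono) auto
      moreover have "0 \<le> (b - a) * (real i / real n)"
        using \<open>a \<le> b\<close> by simp
      ultimately show ?thesis by (simp add: p_def)
    qed
    have p_step: "p (Suc i) - p i = (b - a) / n" for i
      using \<open>n > 0\<close> by (simp add: p_def field_simps)
    have step: "norm (F (p (Suc i)) - F (p i)) \<le> \<epsilon> * (\<Phi> (p (Suc i)) - \<Phi> (p i))" if "i < n" for i
    proof (rule \<delta>)
      show "p (Suc i) - p i < \<delta>"
        using n \<open>n > 0\<close> \<open>\<delta> > 0\<close> unfolding p_step by (simp add: field_simps)
      show "p i \<le> p (Suc i)"
        using p_step[of i] \<open>a \<le> b\<close> by (smt (verit) divide_nonneg_nonneg of_nat_0_le_iff)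
    qed (use that p_mem in auto)
    have "norm (F (p n) - F (p 0)) = norm (\<Sum>i<n. F (p (Suc i)) - F (p i))"
      using sum_lessThan_telescope[of "\<lambda>i. F (p i)" n] by simp
    also have "\<dots> \<le> (\<Sum>i<n. \<epsilon> * (\<Phi> (p (Suc i)) - \<Phi> (p i)))"
      by (rule sum_norm_le) (use step in auto)
    also have "\<dots> = \<epsilon> * (\<Phi> (p n) - \<Phi> (p 0))"
      using sum_lessThan_telescope[of "\<lambda>i. \<Phi> (p i)" n] by (simp add: sum_distrib_left[symmetric])
    finally show ?thesis
      using \<open>n > 0\<close> by (simp add: p_def)
  qed
  show ?thesis
  proof (rule ccontr)
    assume "F b \<noteq> F a"
    then have pos: "norm (F b - F a) > 0" by simp
    \<comment> \<open>The added 1 keeps \<open>K\<close> positive; the choice of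
      \<open>\<epsilon>\<close> below then bounds the norm by half of itself.\<close>
    define K where "K = \<bar>\<Phi> b - \<Phi> a\<bar> + 1"
    have "K > 0" by (simp add: K_def)
    have "norm (F b - F a) \<le> norm (F b - F a) / (2 * K) * (\<Phi> b - \<Phi> a)"
      using pos \<open>K > 0\<close> by (intro bound) auto
    also have "\<dots> \<le> norm (F b - F a) / (2 * K) * K"
      using pos \<open>K > 0\<close> by (intro mult_left_mono) (auto simp: K_def)
    also have "\<dots> = norm (F b - F a) / 2"
      using \<open>K > 0\<close> by simp
    finally show False using pos by simp
  qed
qed

lemma ac_deriv_abs_integrable:
  "ac_deriv l f h \<Longrightarrow> h absolutely_integrable_on {0..l}"
  by (simp add: ac_deriv_def)

lemma ac_deriv_has_integral:
  assumes "ac_deriv l f h" "0 \<le> a" "a \<le> b" "b \<le> l"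
  shows "(h has_integral (f b - f a)) {a..b}"
proof -
  have a: "(h has_integral (f a - f 0)) {0..a}" and b: "(h has_integral (f b - f 0)) {0..b}"
    using assms by (auto simp: ac_deriv_def)
  have "h integrable_on {a..b}"
    using b assms by (auto intro: integrable_on_subinterval)
  then obtain j where j: "(h has_integral j) {a..b}" by blast
  have "f a - f 0 + j = f b - f 0"
    using has_integral_combine[OF assms(2,3) a j] b has_integral_unique by blast
  then have "j = f b - f a" by (simp add: algebra_simps)
  then show ?thesis using j by simp
qed

lemma ac_deriv_continuous_on:
  assumes "ac_deriv l f h"
  shows "continuous_on {0..l} f"
proof -
  have "h integrable_on {0..l}"
    using ac_deriv_abs_integrable[OF assms] set_lebesgue_integral_eq_integral(1) by blast
  then have "continuous_on {0..l} (\<lambda>x. integral {0..x} h + f 0)"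
    by (intro continuous_intros indefinite_integral_continuous_1)
  moreover have "integral {0..x} h + f 0 = f x" if "x \<in> {0..l}" for x
  proof -
    have "integral {0..x} h = f x - f 0"
      using assms that unfolding ac_deriv_def by (blast intro: integral_unique)
    then show ?thesis by simp
  qed
  ultimately show ?thesis
    using continuous_on_cong by (metis (no_types, lifting))
qed

lemma ac_derivI_C1:
  fixes f :: "real \<Rightarrow> 'a::euclidean_space"
  assumes "\<And>x. x \<in> {0..l} \<Longrightarrow> (f has_vector_derivative h x) (at x within {0..l})"
    and "continuous_on {0..l} h"
  shows "ac_deriv l f h"
  unfolding ac_deriv_def
proof (intro conjI ballI)
  show "h absolutely_integrable_on {0..l}"
    using assms(2) by (rule absolutely_integrable_continuous_real)
  fix x assume x: "x \<in> {0..l}"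
  show "(h has_integral f x - f 0) {0..x}"
    using x by (intro fundamental_theorem_of_calculus)
      (auto intro!: has_vector_derivative_within_subset[OF assms(1)])
qed

lemma ac_deriv_add:
  assumes "ac_deriv l f f'" "ac_deriv l g g'"
  shows "ac_deriv l (\<lambda>x. f x + g x) (\<lambda>x. f' x + g' x)"
  unfolding ac_deriv_def
proof (intro conjI ballI)
  fix x assume "x \<in> {0..l}"
  with assms have "(f' has_integral (f x - f 0)) {0..x}" "(g' has_integral (g x - g 0)) {0..x}"
    by (auto simp: ac_deriv_def)
  from has_integral_add[OF this]
  show "((\<lambda>x. f' x + g' x) has_integral f x + g x - (f 0 + g 0)) {0..x}"
    by (simp add: algebra_simps)
qed (intro set_integral_add(1) assms[THEN ac_deriv_abs_integrable])

lemma ac_deriv_diff: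
  assumes "ac_deriv l f f'" "ac_deriv l g g'"
  shows "ac_deriv l (\<lambda>x. f x - g x) (\<lambda>x. f' x - g' x)"
  unfolding ac_deriv_def
proof (intro conjI ballI)
  fix x assume "x \<in> {0..l}"
  with assms have "(f' has_integral (f x - f 0)) {0..x}" "(g' has_integral (g x - g 0)) {0..x}"
    by (auto simp: ac_deriv_def)
  from has_integral_diff[OF this]
  show "((\<lambda>x. f' x - g' x) has_integral f x - g x - (f 0 - g 0)) {0..x}"
    by (simp add: algebra_simps)
qed (intro set_integral_diff(1) assms[THEN ac_deriv_abs_integrable])

lemma ac_deriv_of_real:
  assumes "ac_deriv l f f'"
  shows "ac_deriv l (\<lambda>x. of_real (f x) :: complex) (\<lambda>x. of_real (f' x))"
  unfolding ac_deriv_def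
proof (intro conjI ballI)
  show "(\<lambda>x. of_real (f' x) :: complex) absolutely_integrable_on {0..l}"
    using absolutely_integrable_linear[OF ac_deriv_abs_integrable[OF assms] bounded_linear_of_real]
    by (simp add: o_def)
  fix x assume "x \<in> {0..l}"
  then have "(f' has_integral (f x - f 0)) {0..x}"
    using assms by (simp add: ac_deriv_def)
  from has_integral_linear[OF this bounded_linear_of_real]
  show "((\<lambda>x. of_real (f' x) :: complex) has_integral of_real (f x) - of_real (f 0)) {0..x}"
    by (simp add: o_def)
qed

text \<open>A continuous function on a compact interval is bounded and measurable. Both orders are
  stated since the algebra need not be commutative.\<close>

lemma absolutely_integrable_mult_continuous:
  fixes f g :: "real \<Rightarrow> 'a::{euclidean_space,real_normed_algebra}"
  assumes "continuous_on {a..b} f" "g absolutely_integrable_on {a..b}"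
  shows "(\<lambda>x. f x * g x) absolutely_integrable_on {a..b}"
    and "(\<lambda>x. g x * f x) absolutely_integrable_on {a..b}"
proof -
  have *: "f \<in> borel_measurable (lebesgue_on {a..b})" "bounded (f ` {a..b})"
    using assms(1) by (auto intro!: continuous_imp_measurable_on_sets_lebesgue
        compact_imp_bounded compact_continuous_image)
  have "bilinear (\<lambda>x y :: 'a. x * y)" "bilinear (\<lambda>x y :: 'a. y * x)"
    using bilinear_times by (auto simp: bilinear_def)
  from this[THEN absolutely_integrable_bounded_measurable_product, OF *(1) _ *(2) assms(2)]
  show "(\<lambda>x. f x * g x) absolutely_integrable_on {a..b}"
    and "(\<lambda>x. g x * f x) absolutely_integrable_on {a..b}"
    by auto
qed

text \<open>The difference \<open>F\<close> of \<open>f * g\<close> and the integral of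
  \<open>?h\<close> has over \<open>{x..y}\<close> the increment given by the integral of
  \<open>f' t * (g y - g t) + (f x - f t) * g' t\<close>. Uniform continuity of \<open>f\<close> and
  \<open>g\<close> bounds it by \<open>\<epsilon>\<close> times the integral of
  \<open>norm (f' t) + norm (g' t)\<close>, so \<open>F\<close> is constant by the lemma on
  dominated increments.\<close>

lemma ac_deriv_mult:
  fixes f g :: "real \<Rightarrow> 'a::{euclidean_space,real_normed_algebra}"
  assumes f: "ac_deriv l f f'" and g: "ac_deriv l g g'"
  shows "ac_deriv l (\<lambda>x. f x * g x) (\<lambda>x. f' x * g x + f x * g' x)"
  unfolding ac_deriv_def
proof (intro conjI ballI)
  have cf: "continuous_on {0..l} f" and cg: "continuous_on {0..l} g"
    using f g by (auto dest: ac_deriv_continuous_on)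
  let ?h = "\<lambda>x. f' x * g x + f x * g' x"
  let ?m = "\<lambda>x. norm (f' x) + norm (g' x)"
  show h: "?h absolutely_integrable_on {0..l}"
    by (intro set_integral_add(1) absolutely_integrable_mult_continuous cf cg
        ac_deriv_abs_integrable[OF f] ac_deriv_abs_integrable[OF g])
  have m: "?m absolutely_integrable_on {0..l}"
    by (intro set_integral_add(1) set_integrable_norm
        ac_deriv_abs_integrable[OF f] ac_deriv_abs_integrable[OF g])
  have hint: "?h integrable_on {0..l}" and mint: "?m integrable_on {0..l}"
    using h m set_lebesgue_integral_eq_integral(1) by blast+
  fix z assume z: "z \<in> {0..l}"
  define F where "F x = f x * g x - integral {0..x} ?h" for x
  define \<Phi> where "\<Phi> x = integral {0..x} ?m" for x
  have "F z = F 0"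
  proof (rule eq_of_dominated_increments)
    show "0 \<le> z" using z by simp
    fix \<epsilon> :: real assume "\<epsilon> > 0"
    have "uniformly_continuous_on {0..l} f" "uniformly_continuous_on {0..l} g"
      using cf cg by (auto intro: compact_uniformly_continuous)
    then obtain d1 d2 where d: "d1 > 0" "d2 > 0"
      and d1: "\<And>x y. x \<in> {0..l} \<Longrightarrow> y \<in> {0..l} \<Longrightarrow> dist y x < d1 \<Longrightarrow> dist (f y) (f x) < \<epsilon>"
      and d2: "\<And>x y. x \<in> {0..l} \<Longrightarrow> y \<in> {0..l} \<Longrightarrow> dist y x < d2 \<Longrightarrow> dist (g y) (g x) < \<epsilon>"
      unfolding uniformly_continuous_on_def using \<open>\<epsilon> > 0\<close> by metis
    have "norm (F y - F x) \<le> \<epsilon> * (\<Phi> y - \<Phi> x)"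
      if x: "x \<in> {0..z}" and y: "y \<in> {0..z}" and xy: "x \<le> y" "y - x < min d1 d2" for x y
    proof -
      have sub: "{x..y} \<subseteq> {0..l}" and yl: "y \<le> l" and x0: "0 \<le> x" using x y z by auto
      have hxy: "?h integrable_on {x..y}" and mxy: "?m integrable_on {x..y}"
        using hint mint sub integrable_on_subinterval by blast+
      have hy: "?h integrable_on {0..y}" and my: "?m integrable_on {0..y}"
        by (rule integrable_on_subinterval[OF hint] integrable_on_subinterval[OF mint]; use yl in auto)+
      have ihdiff: "integral {0..y} ?h - integral {0..x} ?h = integral {x..y} ?h"
        using Henstock_Kurzweil_Integration.integral_combine[OF x0 xy(1) hy]
        by (simp add: algebra_simps)
      have imdiff: "\<Phi> y - \<Phi> x = integral {x..y} ?m"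
        using Henstock_Kurzweil_Integration.integral_combine[OF x0 xy(1) my]
        by (simp add: \<Phi>_def algebra_simps)
      \<comment> \<open>Freezing \<open>g\<close> at the right end and \<open>f\<close> at the left
        end gives an integrand whose integral is exactly the increment of
        \<open>f * g\<close>.\<close>
      let ?e = "\<lambda>t. (f' t * g y + f x * g' t) - ?h t"
      have "((\<lambda>t. f' t * g y + f x * g' t) has_integral ((f y - f x) * g y + f x * (g y - g x))) {x..y}"
        by (intro has_integral_add has_integral_mult_left has_integral_mult_right
            ac_deriv_has_integral[OF f] ac_deriv_has_integral[OF g] x0 xy(1) yl)
      from has_integral_diff[OF this integrable_integral[OF hxy]]
      have e: "(?e has_integral (F y - F x)) {x..y}"
        using ihdiff by (simp add: F_def algebra_simps)
      have "norm (F y - F x) = norm (integral {x..y} ?e)"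
        using integral_unique[OF e] by simp
      also have "\<dots> \<le> integral {x..y} (\<lambda>t. \<epsilon> * ?m t)"
      proof (rule integral_norm_bound_integral)
        show "?e integrable_on {x..y}" using e by blast
        show "(\<lambda>t. \<epsilon> * ?m t) integrable_on {x..y}"
          using mxy by (intro integrable_on_mult_right)
        fix t assume t: "t \<in> {x..y}"
        then have tl: "t \<in> {0..l}" "x \<in> {0..l}" "y \<in> {0..l}" using sub xy by auto
        have "dist (g y) (g t) < \<epsilon>" "dist (f t) (f x) < \<epsilon>"
          using t xy(2) tl by (auto intro!: d1 d2 simp: dist_real_def)
        then have gf: "norm (g y - g t) \<le> \<epsilon>" "norm (f x - f t) \<le> \<epsilon>"
          by (auto simp: dist_norm norm_minus_commute)
        have "?e t = f' t * (g y - g t) + (f x - f t) * g' t"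
          by (simp add: algebra_simps)
        also have "norm \<dots> \<le> norm (f' t) * norm (g y - g t) + norm (f x - f t) * norm (g' t)"
          by (intro norm_triangle_mono norm_mult_ineq)
        also have "\<dots> \<le> norm (f' t) * \<epsilon> + \<epsilon> * norm (g' t)"
          using gf by (intro add_mono mult_left_mono mult_right_mono) auto
        finally show "norm (?e t) \<le> \<epsilon> * ?m t" by (simp add: algebra_simps)
      qed
      also have "\<dots> = \<epsilon> * (\<Phi> y - \<Phi> x)"
        unfolding imdiff by (rule integral_mult_right)
      finally show ?thesis .
    qed
    then show "\<exists>\<delta>>0. \<forall>x\<in>{0..z}. \<forall>y\<in>{0..z}. x \<le> y \<longrightarrow> y - x < \<delta> \<longrightarrow>
        norm (F y - F x) \<le> \<epsilon> * (\<Phi> y - \<Phi> x)"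
      using d by (intro exI[of _ "min d1 d2"]) auto
  qed
  then have "f z * g z - f 0 * g 0 = integral {0..z} ?h"
    by (simp add: F_def algebra_simps)
  moreover have "?h integrable_on {0..z}"
    by (rule integrable_on_subinterval[OF hint]) (use z in auto)
  ultimately show "(?h has_integral f z * g z - f 0 * g 0) {0..z}"
    by (simp add: has_integral_integral)
qed

section \<open>Derivatives relative to the closed interval and exceptional null sets\<close>

lemma D_eqI:
  assumes "l > 0" "x \<in> {0..l}" "(f has_vector_derivative f') (at x within {0..l})"
  shows "D l f x = f'"
  unfolding D_def using assms by (rule vector_derivative_within_closed_interval)

lemma D_has_vector_derivative:
  assumes "f differentiable_on {0..l}" "x \<in> {0..l}"
  shows "(f has_vector_derivative D l f x) (at x within {0..l})"
  unfolding D_def using assms by (simp add: differentiable_on_def vector_derivative_works[symmetric])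

lemma differentiable_onI_vector:
  assumes "\<And>x. x \<in> S \<Longrightarrow> (f has_vector_derivative f' x) (at x within S)"
  shows "f differentiable_on S"
  using assms by (auto simp: differentiable_on_def intro: differentiableI_vector)

text \<open>The two endpoints join the exceptional null set, so that an equation stated on the open
  interval can be used with \<open>ac_deriv\<close>, which refers to the closed one.\<close>

lemma AE_open_interval_negligible:
  fixes a b :: real
  assumes "AE x in lebesgue_on {a<..<b}. P x"
  obtains N where "negligible N" "\<And>x. x \<in> {a..b} - N \<Longrightarrow> P x"
proof -
  have "AE x in lebesgue. x \<in> {a<..<b} \<longrightarrow> P x"
    using assms by (subst (asm) AE_restrict_space_iff) auto
  then obtain N where N: "N \<in> null_sets lebesgue" "{x. \<not> (x \<in> {a<..<b} \<longrightarrow> P x)} \<subseteq> N"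
    unfolding eventually_ae_filter by auto
  have "negligible (N \<union> {a, b})"
    using N(1) by (simp add: negligible_iff_null_sets negligible_Un)
  then show ?thesis
    by (rule that) (use N(2) in force)
qed

lemma ac_deriv_spike:
  assumes "ac_deriv l f h" "negligible N" "\<And>x. x \<in> {0..l} - N \<Longrightarrow> h' x = h x"
  shows "ac_deriv l f h'"
  unfolding ac_deriv_def
proof (intro conjI ballI)
  show "h' absolutely_integrable_on {0..l}"
    using absolutely_integrable_spike[OF ac_deriv_abs_integrable[OF assms(1)] assms(2,3)] .
  fix x assume x: "x \<in> {0..l}"
  show "(h' has_integral f x - f 0) {0..x}"
    by (rule has_integral_spike[OF assms(2), of _ _ h])
      (use assms(1,3) x in \<open>auto simp: ac_deriv_def\<close>)
qed

lemma ac_deriv_cong: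
  assumes "ac_deriv l f h" "\<And>x. x \<in> {0..l} \<Longrightarrow> g x = f x"
  shows "ac_deriv l g h"
  using assms unfolding ac_deriv_def by auto

text \<open>The indefinite integral of a continuous function is differentiable at every point. This
  upgrades an equation that holds almost everywhere to one that holds everywhere, endpoints
  included.\<close>

lemma ac_deriv_continuous_has_vector_derivative:
  assumes "ac_deriv l f h" "continuous_on {0..l} h" "x \<in> {0..l}"
  shows "(f has_vector_derivative h x) (at x within {0..l})"
proof -
  have "((\<lambda>x. f 0 + integral {0..x} h) has_vector_derivative h x) (at x within {0..l})"
    using has_vector_derivative_add[OF has_vector_derivative_const
        integral_has_vector_derivative[OF assms(2,3)], of "f 0"] by simp
  then show ?thesis
    by (rule has_vector_derivative_transform[OF assms(3), rotated])
      (use assms(1) in \<open>auto simp: ac_deriv_def dest!: bspec integral_unique\<close>)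
qed

lemma has_vector_derivative_0_constant:
  assumes "convex S" "\<And>x. x \<in> S \<Longrightarrow> (f has_vector_derivative 0) (at x within S)"
    and "x \<in> S" "y \<in> S"
  shows "f x = f y"
  using has_derivative_zero_constant[OF assms(1), of f] assms(2-4)
  by (auto simp: has_vector_derivative_def)

lemma has_vector_derivative_quotient:
  fixes f g :: "real \<Rightarrow> 'a::real_normed_field"
  assumes "(f has_vector_derivative f') (at x within S)" "(g has_vector_derivative g') (at x within S)"
    and "g x \<noteq> 0"
  shows "((\<lambda>x. f x / g x) has_vector_derivative (f' * g x - f x * g') / (g x)\<^sup>2) (at x within S)"
  using has_derivative_divide'[OF assms(1,2)[unfolded has_vector_derivative_def] assms(3)]
  by (simp add: has_vector_derivative_def power2_eq_square scaleR_diff_right[symmetric] divide_inverse)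

section \<open>Linear systems depending on a parameter\<close>

text \<open>The Weierstrass M-test makes the series of derivatives converge uniformly, as termwise
  differentiation requires.\<close>

lemma has_vector_derivative_series:
  fixes a d :: "nat \<Rightarrow> real \<Rightarrow> 'a::banach"
  assumes "convex S"
    and deriv: "\<And>n x. x \<in> S \<Longrightarrow> (a n has_vector_derivative d n x) (at x within S)"
    and bound: "\<And>n x. x \<in> S \<Longrightarrow> norm (d n x) \<le> M n" and "summable M"
    and summ: "\<And>x. x \<in> S \<Longrightarrow> summable (\<lambda>n. a n x)"
    and "x \<in> S"
  shows "((\<lambda>x. \<Sum>n. a n x) has_vector_derivative (\<Sum>n. d n x)) (at x within S)"
proof -
  have unif: "uniform_limit S (\<lambda>n x. \<Sum>i<n. d i x) (\<lambda>x. \<Sum>i. d i x) sequentially"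
    using bound \<open>summable M\<close> by (rule Weierstrass_m_test)
  have "\<exists>g. \<forall>x\<in>S. (\<lambda>n. a n x) sums g x \<and>
      (g has_derivative (\<lambda>h. h *\<^sub>R (\<Sum>n. d n x))) (at x within S)"
  proof (rule has_derivative_series[where f' = "\<lambda>n x h. h *\<^sub>R d n x" and x = x and l = "\<Sum>n. a n x"])
    show "(a n has_derivative (\<lambda>h. h *\<^sub>R d n x)) (at x within S)" if "x \<in> S" for n x
      using deriv[OF that] by (simp add: has_vector_derivative_def)
    fix e :: real assume "e > 0"
    with unif have "\<forall>\<^sub>F n in sequentially. \<forall>x\<in>S. dist (\<Sum>i<n. d i x) (\<Sum>i. d i x) < e"
      by (rule uniform_limitD)
    then show "\<forall>\<^sub>F n in sequentially. \<forall>x\<in>S. \<forall>h.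
        norm ((\<Sum>i<n. h *\<^sub>R d i x) - h *\<^sub>R (\<Sum>n. d n x)) \<le> e * norm h"
    proof eventually_elim
      case (elim n)
      show ?case
      proof (intro ballI allI)
        fix x h assume "x \<in> S"
        then have "norm ((\<Sum>i<n. d i x) - (\<Sum>i. d i x)) \<le> e"
          using elim by (simp add: dist_norm less_imp_le)
        moreover have "(\<Sum>i<n. h *\<^sub>R d i x) - h *\<^sub>R (\<Sum>n. d n x)
            = h *\<^sub>R ((\<Sum>i<n. d i x) - (\<Sum>i. d i x))"
          by (simp add: scaleR_sum_right scaleR_diff_right)
        ultimately show "norm ((\<Sum>i<n. h *\<^sub>R d i x) - h *\<^sub>R (\<Sum>n. d n x)) \<le> e * norm h"
          by (simp add: mult.commute[of e] mult_left_mono)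
      qed
    qed
  next
    show "(\<lambda>n. a n x) sums (\<Sum>n. a n x)"
      using summ[OF \<open>x \<in> S\<close>] by (rule summable_sums)
  qed (fact \<open>convex S\<close> \<open>x \<in> S\<close>)+
  then obtain g where g: "\<And>x. x \<in> S \<Longrightarrow> (\<lambda>n. a n x) sums g x"
    and g': "(g has_vector_derivative (\<Sum>n. d n x)) (at x within S)"
    using \<open>x \<in> S\<close> unfolding has_vector_derivative_def by blast
  show ?thesis
    by (rule has_vector_derivative_transform[OF \<open>x \<in> S\<close> _ g']) (use g in \<open>simp add: sums_iff\<close>)
qed

text \<open>These are the terms of Picard iteration (the Peano-Baker series). The weight may depend
  on the order, so that one recursion with two alternating weights solves a system of two
  equations.\<close>

primrec iterated_integral :: "(nat \<Rightarrow> real \<Rightarrow> real) \<Rightarrow> nat \<Rightarrow> real \<Rightarrow> real" where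
  "iterated_integral \<rho> 0 = (\<lambda>x. 1)"
| "iterated_integral \<rho> (Suc n) = (\<lambda>x. integral {0..x} (\<lambda>t. \<rho> n t * iterated_integral \<rho> n t))"

lemma continuous_on_iterated_integral:
  assumes "\<And>n. continuous_on {0..l} (\<rho> n)"
  shows "continuous_on {0..l} (iterated_integral \<rho> n)"
proof (induction n)
  case (Suc n)
  then have "(\<lambda>t. \<rho> n t * iterated_integral \<rho> n t) integrable_on {0..l}"
    by (intro integrable_continuous_real continuous_on_mult assms)
  then show ?case
    by (simp add: indefinite_integral_continuous_1)
qed simp

lemma iterated_integral_deriv:
  assumes "\<And>n. continuous_on {0..l} (\<rho> n)" "x \<in> {0..l}"
  shows "(iterated_integral \<rho> (Suc n) has_vector_derivative \<rho> n x * iterated_integral \<rho> n x)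
           (at x within {0..l})"
  using assms continuous_on_iterated_integral[OF assms(1)]
  by (auto intro!: integral_has_vector_derivative continuous_on_mult)

text \<open>Integrating \<open>B * ((B * t) ^ n / fact n)\<close> raises the power and the factorial
  together. The factorial later makes the series in the parameter converge everywhere.\<close>

lemma iterated_integral_bound:
  assumes cont: "\<And>n. continuous_on {0..l} (\<rho> n)"
    and B: "\<And>n t. t \<in> {0..l} \<Longrightarrow> \<bar>\<rho> n t\<bar> \<le> B" and x: "x \<in> {0..l}"
  shows "\<bar>iterated_integral \<rho> n x\<bar> \<le> (B * x) ^ n / fact n"
  using x
proof (induction n arbitrary: x)
  case (Suc n)
  have "B \<ge> 0" using B[of 0 0] Suc.prems by force
  have int: "((\<lambda>t. B * ((B * t) ^ n / fact n)) has_integral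
      (B * x) ^ Suc n / fact (Suc n) - (B * 0) ^ Suc n / fact (Suc n)) {0..x}"
  proof (rule fundamental_theorem_of_calculus)
    fix t assume "t \<in> {0..x}"
    have "((\<lambda>t. (B * t) ^ Suc n / fact (Suc n)) has_real_derivative
        real (Suc n) * (B * t) ^ n * B / fact (Suc n)) (at t within {0..x})"
      by (rule derivative_eq_intros refl | simp)+
    moreover have "real (Suc n) * (B * t) ^ n * B / fact (Suc n) = B * ((B * t) ^ n / fact n)"
      by (simp add: field_simps del: of_nat_Suc)
    ultimately have "((\<lambda>t. (B * t) ^ Suc n / fact (Suc n)) has_real_derivative
        B * ((B * t) ^ n / fact n)) (at t within {0..x})"
      by (simp only:)
    then show "((\<lambda>t. (B * t) ^ Suc n / fact (Suc n)) has_vector_derivative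
        B * ((B * t) ^ n / fact n)) (at t within {0..x})"
      by (simp only: has_real_derivative_iff_has_vector_derivative)
  qed (use Suc.prems in auto)
  have "norm (integral {0..x} (\<lambda>t. \<rho> n t * iterated_integral \<rho> n t))
      \<le> integral {0..x} (\<lambda>t. B * ((B * t) ^ n / fact n))"
  proof (rule integral_norm_bound_integral)
    have "continuous_on {0..l} (\<lambda>t. \<rho> n t * iterated_integral \<rho> n t)"
      by (intro continuous_on_mult cont continuous_on_iterated_integral)
    then show "(\<lambda>t. \<rho> n t * iterated_integral \<rho> n t) integrable_on {0..x}"
      by (rule integrable_continuous_real[OF continuous_on_subset]) (use Suc.prems in auto)
    show "(\<lambda>t. B * ((B * t) ^ n / fact n)) integrable_on {0..x}"
      using int by blast
    show "norm (\<rho> n t * iterated_integral \<rho> n t) \<le> B * ((B * t) ^ n / fact n)" if "t \<in> {0..x}" for t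
    proof -
      have "t \<in> {0..l}" using that Suc.prems by auto
      then show ?thesis
        unfolding real_norm_def abs_mult using \<open>B \<ge> 0\<close> Suc.IH B by (intro mult_mono) auto
    qed
  qed
  also have "\<dots> = (B * x) ^ Suc n / fact (Suc n)"
    using integral_unique[OF int] by simp
  finally show ?case by simp
qed simp

text \<open>Convergence at every \<open>w\<close> gives holomorphy on every ball about 0, and these
  balls exhaust the plane.\<close>

lemma entire_power_series:
  fixes a :: "nat \<Rightarrow> complex"
  assumes "\<And>w. summable (\<lambda>n. a n * w ^ n)"
  shows "(\<lambda>w. \<Sum>n. a n * w ^ n) holomorphic_on UNIV"
proof -
  have "(\<lambda>w. \<Sum>n. a n * w ^ n) holomorphic_on ball 0 r" for r
    by (rule power_series_holomorphic[where a = a]) (simp add: assms summable_sums)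
  then have "(\<lambda>w. \<Sum>n. a n * w ^ n) field_differentiable at w" for w
    by (rule holomorphic_on_imp_differentiable_at[of _ "ball 0 (norm w + 1)"]) auto
  then show ?thesis
    by (simp add: holomorphic_on_def field_differentiable_at_within)
qed

text \<open>
  The coefficients of the power series in \<open>w\<close> are the iterated integrals with the weights \<open>\<beta>\<close> and
  \<open>\<alpha>\<close> in turn; even orders make up \<open>f\<close> and odd orders make up \<open>h\<close>.
\<close>

lemma linear_system_power_series:
  fixes \<alpha> \<beta> :: "real \<Rightarrow> real"
  assumes "continuous_on {0..l} \<alpha>" and "continuous_on {0..l} \<beta>" and "l \<ge> 0"
  obtains f h :: "complex \<Rightarrow> real \<Rightarrow> complex" where
    "\<And>w. f w 0 = 1" and "\<And>w. h w 0 = 0"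
    and "\<And>w x. x \<in> {0..l} \<Longrightarrow>
      (f w has_vector_derivative w * of_real (\<alpha> x) * h w x) (at x within {0..l})"
    and "\<And>w x. x \<in> {0..l} \<Longrightarrow>
      (h w has_vector_derivative of_real (\<beta> x) * f w x) (at x within {0..l})"
    and "\<And>x. x \<in> {0..l} \<Longrightarrow> (\<lambda>w. f w x) holomorphic_on UNIV"
    and "\<And>x. x \<in> {0..l} \<Longrightarrow> (\<lambda>w. h w x) holomorphic_on UNIV"
proof -
  define \<rho> where "\<rho> n = (if even n then \<beta> else \<alpha>)" for n :: nat
  define y where "y = iterated_integral \<rho>"
  have cont: "continuous_on {0..l} (\<rho> n)" for n
    using assms by (simp add: \<rho>_def)
  have "bounded (\<alpha> ` {0..l} \<union> \<beta> ` {0..l})"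
    using assms by (auto intro!: compact_imp_bounded compact_continuous_image)
  then obtain B where "\<forall>b \<in> \<alpha> ` {0..l} \<union> \<beta> ` {0..l}. norm b \<le> B"
    unfolding bounded_iff by blast
  then have B: "\<bar>\<rho> n x\<bar> \<le> B" if "x \<in> {0..l}" for n x
    using that by (auto simp: \<rho>_def)
  have "B \<ge> 0" using B[of 0 0] \<open>l \<ge> 0\<close> by force
  define K where "K = B * l"
  have "K \<ge> 0" using \<open>B \<ge> 0\<close> \<open>l \<ge> 0\<close> by (simp add: K_def)
  have y_bound: "\<bar>y n x\<bar> \<le> K ^ n / fact n" if x: "x \<in> {0..l}" for n x
  proof -
    have "\<bar>y n x\<bar> \<le> (B * x) ^ n / fact n"
      unfolding y_def using cont B x by (rule iterated_integral_bound)
    also have "\<dots> \<le> K ^ n / fact n"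
      using x \<open>B \<ge> 0\<close> by (intro divide_right_mono power_mono) (auto simp: K_def mult_left_mono)
    finally show ?thesis .
  qed
  \<comment> \<open>The majorant comes from splitting \<open>K ^ (2 * m + j)\<close> into
    \<open>K ^ j\<close> and \<open>(K\<^sup>2) ^ m\<close> and from weakening
    \<open>fact (2 * m + j)\<close> to \<open>fact m\<close>; what remains is an exponential series
    in \<open>cmod w * K\<^sup>2\<close>.\<close>
  define M where "M w j m = K ^ j * ((cmod w * K\<^sup>2) ^ m / fact m)" for w j m
  have M_summable: "summable (M w j)" for w j
    unfolding M_def using summable_exp[of "cmod w * K\<^sup>2"]
    by (intro summable_mult) (simp add: field_simps)
  have M_nonneg: "M w j m \<ge> 0" for w j m
    using \<open>K \<ge> 0\<close> by (simp add: M_def)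
  have term_bound: "norm (w ^ m * of_real (y (2 * m + j) x)) \<le> M w j m" if x: "x \<in> {0..l}" for w m j x
  proof -
    have "(fact m :: real) \<le> fact (2 * m + j)"
      by (rule fact_mono) simp
    then have "K ^ (2 * m + j) / fact (2 * m + j) \<le> K ^ (2 * m + j) / fact m"
      using \<open>K \<ge> 0\<close> by (intro divide_left_mono) auto
    then have "\<bar>y (2 * m + j) x\<bar> \<le> K ^ (2 * m + j) / fact m"
      using y_bound[OF x, of "2 * m + j"] by linarith
    then have "cmod w ^ m * \<bar>y (2 * m + j) x\<bar> \<le> cmod w ^ m * (K ^ (2 * m + j) / fact m)"
      by (intro mult_left_mono) auto
    also have "\<dots> = M w j m"
      unfolding M_def power_mult_distrib power_add power_mult[of K 2 m] by simp
    finally show ?thesis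
      by (simp add: norm_mult norm_power)
  qed
  \<comment> \<open>The orders \<open>j, j + 2, ...\<close> are collected in \<open>s j\<close>.
    Since \<open>\<rho>\<close> has period two, all derivatives of the terms of
    \<open>s (Suc j)\<close> share the factor \<open>\<rho> j\<close>, and the terms of
    \<open>s j\<close> remain.\<close>
  define s where "s j w x = (\<Sum>m. w ^ m * complex_of_real (y (2 * m + j) x))" for j w x
  have summ: "summable (\<lambda>m. w ^ m * complex_of_real (y (2 * m + j) x))" if "x \<in> {0..l}" for j w x
    using summable_comparison_test'[OF M_summable term_bound[OF that]] by blast
  have s_deriv: "(s (Suc j) w has_vector_derivative of_real (\<rho> j x) * s j w x) (at x within {0..l})"
    if x: "x \<in> {0..l}" for j w x
  proof -
    have "((\<lambda>x. \<Sum>m. w ^ m * complex_of_real (y (2 * m + Suc j) x)) has_vector_derivative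
        (\<Sum>m. of_real (\<rho> j x) * (w ^ m * complex_of_real (y (2 * m + j) x)))) (at x within {0..l})"
    proof (rule has_vector_derivative_series[where M = "\<lambda>m. B * M w j m"])
      fix m t assume t: "t \<in> {0..l}"
      have "\<rho> (2 * m + j) = \<rho> j" by (simp add: \<rho>_def)
      then have "(y (2 * m + Suc j) has_real_derivative \<rho> j t * y (2 * m + j) t) (at t within {0..l})"
        using iterated_integral_deriv[of l \<rho> t "2 * m + j"] cont t
        by (simp add: y_def has_real_derivative_iff_has_vector_derivative)
      from has_vector_derivative_of_real[OF this]
      have "((\<lambda>t. complex_of_real (y (2 * m + Suc j) t)) has_vector_derivative
          of_real (\<rho> j t * y (2 * m + j) t)) (at t within {0..l})"
        by simp
      from has_vector_derivative_mult_right[OF this, of "w ^ m"]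
      show "((\<lambda>t. w ^ m * complex_of_real (y (2 * m + Suc j) t)) has_vector_derivative
          of_real (\<rho> j t) * (w ^ m * complex_of_real (y (2 * m + j) t))) (at t within {0..l})"
        by (simp add: mult_ac)
      show "norm (of_real (\<rho> j t) * (w ^ m * complex_of_real (y (2 * m + j) t))) \<le> B * M w j m"
        unfolding norm_mult[of "of_real (\<rho> j t)"] norm_of_real
        by (intro mult_mono B[OF t] term_bound[OF t] \<open>B \<ge> 0\<close> norm_ge_zero)
    next
      show "summable (\<lambda>m. B * M w j m)"
        by (rule summable_mult[OF M_summable])
      show "summable (\<lambda>m. w ^ m * complex_of_real (y (2 * m + Suc j) t))" if "t \<in> {0..l}" for t
        by (rule summ[OF that])
    qed (simp_all only: convex_real_interval x)
    then show ?thesis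
      unfolding s_def suminf_mult[OF summ[OF x]] .
  qed
  \<comment> \<open>Shifting the index closes the system: \<open>s 0\<close> is recovered from
    \<open>s 2\<close>, whose derivative is \<open>\<alpha>\<close> times \<open>s 1\<close>, and
    the shift supplies the factor \<open>w\<close>.\<close>
  have s_0: "s 0 w x = 1 + w * s 2 w x" if "x \<in> {0..l}" for w x
  proof -
    have "s 0 w x = (\<Sum>m. w ^ Suc m * complex_of_real (y (2 * Suc m + 0) x)) + w ^ 0 * complex_of_real (y (2 * 0 + 0) x)"
      unfolding s_def using suminf_split_head[OF summ[OF that, of w 0]] by (simp add: algebra_simps)
    also have "\<dots> = 1 + (\<Sum>m. w * (w ^ m * complex_of_real (y (2 * m + 2) x)))"
      by (simp add: y_def mult.assoc)
    also have "\<dots> = 1 + w * s 2 w x"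
      unfolding s_def suminf_mult[OF summ[OF that]] ..
    finally show ?thesis .
  qed
  have y_0: "y (Suc n) 0 = 0" for n
    by (simp add: y_def)
  have s_at_0: "s (Suc j) w 0 = 0" for j w
    by (simp add: s_def y_0)
  have s_hol: "(\<lambda>w. s j w x) holomorphic_on UNIV" if "x \<in> {0..l}" for j x
    using entire_power_series[of "\<lambda>m. of_real (y (2 * m + j) x)"] summ[OF that]
    by (simp add: s_def mult.commute)
  show ?thesis
  proof (rule that[of "s 0" "s 1"])
    fix w x assume x: "x \<in> {0..l}"
    have "(s 2 w has_vector_derivative of_real (\<alpha> x) * s 1 w x) (at x within {0..l})"
      using s_deriv[OF x, of 1] by (simp add: \<rho>_def numeral_2_eq_2)
    then have s2: "((\<lambda>x. 1 + w * s 2 w x) has_vector_derivative w * of_real (\<alpha> x) * s 1 w x) (at x within {0..l})"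
      by (auto intro!: derivative_eq_intros)
    show "(s 0 w has_vector_derivative w * of_real (\<alpha> x) * s 1 w x) (at x within {0..l})"
      by (rule has_vector_derivative_transform[OF x _ s2]) (rule s_0)
    show "(s 1 w has_vector_derivative of_real (\<beta> x) * s 0 w x) (at x within {0..l})"
      using s_deriv[OF x, of 0] by (simp add: \<rho>_def)
  next
    show "s 0 w 0 = 1" for w
      using s_0[of 0 w] s_at_0[of 1 w] \<open>l \<ge> 0\<close> by (simp add: numeral_2_eq_2)
    show "s 1 w 0 = 0" for w
      using s_at_0[of 0 w] by simp
  qed (rule s_hol; assumption)+
qed

section \<open>The impedance and the condition at the lips\<close>

text \<open>Iterating the ratio bound gives \<open>norm (a n) \<le> norm (a 0) / fact n\<close>, so
  an exponential series dominates. The coefficients of the Bessel and of the Struve series both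
  satisfy such a bound.\<close>

lemma summable_if_ratio_bound:
  fixes a :: "nat \<Rightarrow> complex"
  assumes "\<And>n. norm (a (Suc n)) \<le> norm (a n) / real (Suc n)"
  shows "summable (\<lambda>n. a n * w ^ n)"
proof -
  have "norm (a n) \<le> norm (a 0) / fact n" for n
  proof (induction n)
    case (Suc n)
    have "norm (a (Suc n)) \<le> norm (a n) / real (Suc n)" by (rule assms)
    also have "\<dots> \<le> norm (a 0) / fact n / real (Suc n)"
      using Suc by (rule divide_right_mono) simp
    finally show ?case by (simp add: field_simps)
  qed simp
  then have "norm (a n * w ^ n) \<le> norm (a 0) / fact n * norm w ^ n" for n
    by (simp only: norm_mult norm_power) (intro mult_right_mono; simp)
  then have bound: "norm (a n * w ^ n) \<le> norm (a 0) * (inverse (fact n) * norm w ^ n)" for n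
    by (simp add: field_simps)
  have "summable (\<lambda>n. norm (a 0) * (inverse (fact n) * norm w ^ n))"
    by (rule summable_mult[OF summable_exp])
  then show ?thesis
    by (rule summable_comparison_test') (rule bound)
qed

lemma Gamma_of_real_nonzero:
  fixes x :: real
  assumes "x > 0"
  shows "Gamma (complex_of_real x) \<noteq> 0"
  using Gamma_real_pos[OF assms] by (simp add: Gamma_complex_of_real)

text \<open>With \<open>w = k * rl\<close> the defining series read
  \<open>J_1(2 w) = w A(w^2)\<close> and \<open>H_1(2 w) = w^2 B(w^2)\<close>, so that division by
  \<open>w\<close> leaves entire functions. The values \<open>A 0\<close> and \<open>B 0\<close>
  decide the order of the zero of the impedance at 0.\<close>

lemma impedance_expansion:
  assumes "rl \<noteq> 0"
  obtains A B :: "complex \<Rightarrow> complex" where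
    "A holomorphic_on UNIV" and "B holomorphic_on UNIV" and "A 0 = 1" and "B 0 \<noteq> 0"
    and "\<And>k. impedance rl k = 1 - A ((k * of_real rl)\<^sup>2) + \<i> * (k * of_real rl) * B ((k * of_real rl)\<^sup>2)"
proof -
  define a :: "nat \<Rightarrow> complex" where "a m = (-1) ^ m / (fact m * fact (m + 1))" for m
  define b :: "nat \<Rightarrow> complex" where
    "b m = (-1) ^ m / (Gamma (of_nat m + 3 / 2) * Gamma (of_nat m + of_nat 1 + 3 / 2))" for m
  define A where "A w = (\<Sum>m. a m * w ^ m)" for w
  define B where "B w = (\<Sum>m. b m * w ^ m)" for w
  have a: "summable (\<lambda>m. a m * w ^ m)" for w
  proof (rule summable_if_ratio_bound)
    fix n
    have "norm (a (Suc n)) = norm (a n) / real (Suc n) / real (Suc (Suc n))"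
      by (simp add: a_def norm_divide norm_mult norm_power field_simps del: of_nat_Suc)
    also have "\<dots> \<le> norm (a n) / real (Suc n) / 1"
      by (intro divide_left_mono) auto
    finally show "norm (a (Suc n)) \<le> norm (a n) / real (Suc n)" by simp
  qed
  have G: "Gamma (of_nat n + (3 / 2 :: complex)) \<noteq> 0" for n
    using Gamma_of_real_nonzero[of "real n + 3 / 2"] by simp
  \<comment> \<open>The functional equation of Gamma, applied to both Gamma factors, supplies the
    ratio of consecutive Struve coefficients.\<close>
  have Gs: "Gamma (of_nat (Suc n) + (3 / 2 :: complex)) = (of_nat n + 3 / 2) * Gamma (of_nat n + 3 / 2)" for n
  proof -
    have "of_nat n + (3 / 2 :: complex) = complex_of_real (real n + 3 / 2)" by simp
    then have "of_nat n + (3 / 2 :: complex) \<notin> \<int>\<^sub>\<le>\<^sub>0"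
      using of_real_in_nonpos_Ints_iff nonpos_Ints_nonpos by (metis add_nonneg_pos divide_pos_pos not_le of_nat_0_le_iff zero_less_numeral)
    from Gamma_plus1[OF this] show ?thesis by (simp add: add_ac)
  qed
  have b_eq: "b m = (-1) ^ m / (Gamma (of_nat m + 3 / 2) * Gamma (of_nat (Suc m) + 3 / 2))" for m
    by (simp add: b_def add_ac)
  have b: "summable (\<lambda>m. b m * w ^ m)" for w
  proof (rule summable_if_ratio_bound)
    fix n
    have n1: "norm (of_nat n + 3 / 2 :: complex) = real n + 3 / 2"
      using norm_of_real[of "real n + 3 / 2", where 'a = complex] by simp
    have n2: "norm (of_nat (Suc n) + 3 / 2 :: complex) = real (Suc n) + 3 / 2"
      using norm_of_real[of "real (Suc n) + 3 / 2", where 'a = complex] by simp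
    have "norm (b (Suc n)) = norm (b n) / ((real n + 3 / 2) * (real (Suc n) + 3 / 2))"
      unfolding b_eq Gs norm_divide norm_mult norm_power n1 n2
      by (simp only: norm_minus_cancel norm_one power_one divide_divide_eq_left mult_ac)
    also have "\<dots> \<le> norm (b n) / real (Suc n)"
    proof (rule divide_left_mono)
      have "real (Suc n) * 1 \<le> (real n + 3 / 2) * (real (Suc n) + 3 / 2)"
        by (intro mult_mono) auto
      then show "real (Suc n) \<le> (real n + 3 / 2) * (real (Suc n) + 3 / 2)" by simp
    qed auto
    finally show "norm (b (Suc n)) \<le> norm (b n) / real (Suc n)" .
  qed
  have A: "A holomorphic_on UNIV" and B: "B holomorphic_on UNIV"
    unfolding A_def B_def using entire_power_series a b by blast+
  define Z where
    "Z k = 1 - A ((k * of_real rl)\<^sup>2) + \<i> * (k * of_real rl) * B ((k * of_real rl)\<^sup>2)" for k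
  have J: "bessel_J 1 (2 * k * of_real rl) = k * of_real rl * A ((k * of_real rl)\<^sup>2)" for k
    unfolding bessel_J_def A_def suminf_mult[OF a, symmetric]
    by (intro suminf_cong) (simp add: a_def power_add power_mult)
  have even_power: "w ^ (2 * m + 1 + 1) = w\<^sup>2 * (w\<^sup>2) ^ m" for w :: complex and m
    by (simp add: power_mult power2_eq_square)
  have half: "2 * k * of_real rl / 2 = k * (of_real rl :: complex)" for k
    by simp
  have H: "struve_H 1 (2 * k * of_real rl) = (k * of_real rl)\<^sup>2 * B ((k * of_real rl)\<^sup>2)" for k
    unfolding struve_H_def B_def suminf_mult[OF b, symmetric]
    unfolding half even_power b_def by (intro suminf_cong) (simp only: mult_ac)
  have eq: "1 - bessel_J 1 (2 * k * of_real rl) / (k * of_real rl)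
       + \<i> * (struve_H 1 (2 * k * of_real rl) / (k * of_real rl)) = Z k" if "k \<noteq> 0" for k
    using that \<open>rl \<noteq> 0\<close> unfolding J H Z_def by (simp add: field_simps power2_eq_square)
  have Zhol: "Z holomorphic_on UNIV"
    unfolding Z_def
    by (intro holomorphic_intros holomorphic_on_compose_gen[OF _ A, unfolded o_def]
        holomorphic_on_compose_gen[OF _ B, unfolded o_def]) auto
  \<comment> \<open>Away from 0 the original quotient equals \<open>Z\<close>, and \<open>Z\<close>
    is continuous, so the limit taken by \<open>remove_sings\<close> is \<open>Z k\<close> at 0 as
    well.\<close>
  have "impedance rl k = Z k" for k
    unfolding impedance_def
  proof (rule remove_sings_eqI)
    have "isCont Z k"
      using Zhol holomorphic_on_imp_continuous_on continuous_on_eq_continuous_at by blast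
    then have lim: "Z \<midarrow>k\<rightarrow> Z k" by (simp add: isCont_def)
    have "eventually (\<lambda>k'. k' \<noteq> 0) (at k)"
      by (rule eventually_neq_at_within)
    then have "eventually (\<lambda>k'. Z k' = 1 - bessel_J 1 (2 * k' * of_real rl) / (k' * of_real rl)
       + \<i> * (struve_H 1 (2 * k' * of_real rl) / (k' * of_real rl))) (at k)"
      by eventually_elim (rule eq[symmetric])
    then show "(\<lambda>k'. 1 - bessel_J 1 (2 * k' * of_real rl) / (k' * of_real rl)
       + \<i> * (struve_H 1 (2 * k' * of_real rl) / (k' * of_real rl))) \<midarrow>k\<rightarrow> Z k"
      by (rule Lim_transform_eventually[OF lim])
  qed
  moreover have "A 0 = 1" "B 0 \<noteq> 0"
    unfolding A_def B_def powser_zero using G[of 0] G[of 1] by (simp_all add: a_def b_def)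
  ultimately show ?thesis
    using that[OF A B] by (simp add: Z_def)
qed

text \<open>Since \<open>A\<close> and \<open>B\<close> enter through the square of
  \<open>k\<close>, only the explicit factor \<open>k\<close> in front of \<open>B\<close>
  contributes to the derivative at 0, which is \<open>\<i> * rl * B 0\<close>. The zero at 0 is
  therefore simple.\<close>

lemma impedance_properties:
  assumes "rl \<noteq> 0"
  obtains d where "d \<noteq> 0" and "(impedance rl has_field_derivative d) (at 0)"
    and "impedance rl 0 = 0" and "impedance rl holomorphic_on UNIV"
proof -
  obtain A B where hol: "A holomorphic_on UNIV" "B holomorphic_on UNIV" and A0: "A 0 = 1" and B0: "B 0 \<noteq> 0"
    and Z: "\<And>k. impedance rl k = 1 - A ((k * of_real rl)\<^sup>2) + \<i> * (k * of_real rl) * B ((k * of_real rl)\<^sup>2)"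
    using impedance_expansion[OF assms] by metis
  obtain A' B' where A': "(A has_field_derivative A') (at 0)" and B': "(B has_field_derivative B') (at 0)"
    using hol holomorphic_on_imp_differentiable_at[OF _ open_UNIV] unfolding field_differentiable_def by blast
  have sq: "((\<lambda>k. (k * of_real rl)\<^sup>2) has_field_derivative 0) (at 0)"
    by (auto intro!: derivative_eq_intros)
  have A'': "((\<lambda>k. A ((k * of_real rl)\<^sup>2)) has_field_derivative 0) (at 0)"
    using DERIV_chain2[OF _ sq, of A A'] A' by simp
  have B'': "((\<lambda>k. B ((k * of_real rl)\<^sup>2)) has_field_derivative 0) (at 0)"
    using DERIV_chain2[OF _ sq, of B B'] B' by simp
  have "impedance rl = (\<lambda>k. 1 - A ((k * of_real rl)\<^sup>2) + \<i> * (k * of_real rl) * B ((k * of_real rl)\<^sup>2))"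
    using Z by blast
  moreover have "((\<lambda>k. 1 - A ((k * of_real rl)\<^sup>2) + \<i> * (k * of_real rl) * B ((k * of_real rl)\<^sup>2))
      has_field_derivative (\<i> * of_real rl * B 0)) (at 0)"
    by (rule derivative_eq_intros A'' B'' refl | simp)+
  moreover have "(\<lambda>k. 1 - A ((k * of_real rl)\<^sup>2) + \<i> * (k * of_real rl) * B ((k * of_real rl)\<^sup>2)) holomorphic_on UNIV"
    by (intro holomorphic_intros holomorphic_on_compose_gen[OF _ hol(1), unfolded o_def]
        holomorphic_on_compose_gen[OF _ hol(2), unfolded o_def]) auto
  ultimately show ?thesis
    using that[of "\<i> * of_real rl * B 0"] assms A0 B0 by simp
qed

text \<open>Multiplication by the impedance clears the denominator. Where the impedance vanishes,
  the product form reduces to \<open>\<i> * k * p = 0\<close>, which for nonzero \<open>k\<close> is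
  the condition \<open>p = 0\<close> of the definition.\<close>

lemma lip_condition_iff:
  assumes "k \<noteq> 0"
  shows "lip_condition rl k p dp \<longleftrightarrow> dp * impedance rl k + \<i> * k * p = 0"
proof (cases "impedance rl k = 0")
  case False
  then have "dp * impedance rl k + \<i> * k * p = (dp + \<i> * k / impedance rl k * p) * impedance rl k"
    by (simp add: algebra_simps)
  with False assms show ?thesis
    by (simp add: lip_condition_def)
qed (use assms in \<open>simp add: lip_condition_def\<close>)

text \<open>As the impedance has a simple zero with slope \<open>d\<close>, the coefficient tends to
  \<open>\<i> / d\<close>, which is not 0. The derivative argument is 0 because pressure solutions
  at \<open>k = 0\<close> turn out to be constant.\<close>

lemma lip_condition_0:
  assumes "rl \<noteq> 0"
  shows "lip_condition rl 0 p 0 \<longleftrightarrow> p = 0"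
proof -
  obtain d where d: "d \<noteq> 0" "(impedance rl has_field_derivative d) (at 0)" "impedance rl 0 = 0"
    using impedance_properties[OF assms] by metis
  have "((\<lambda>\<kappa>. impedance rl \<kappa> / \<kappa>) \<longlongrightarrow> d) (at 0)"
    using d(2,3) by (simp add: has_field_derivative_iff)
  then have "((\<lambda>\<kappa>. \<i> / (impedance rl \<kappa> / \<kappa>)) \<longlongrightarrow> \<i> / d) (at 0)"
    using d(1) by (intro tendsto_intros)
  then have "((\<lambda>\<kappa>. \<i> * \<kappa> / impedance rl \<kappa>) \<longlongrightarrow> \<i> / d) (at 0)"
    by simp
  then have "Lim (at 0) (\<lambda>\<kappa>. \<i> * \<kappa> / impedance rl \<kappa>) = \<i> / d"
    by (rule tendsto_Lim[rotated]) simp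
  then show ?thesis
    using d(1) by (simp add: lip_condition_def)
qed

text \<open>By the identity theorem a limit point of zeros would make \<open>f\<close> vanish
  identically, against the nonzero derivative at \<open>z\<close>.\<close>

lemma sparse_zeros_of_entire:
  assumes hol: "f holomorphic_on UNIV" and "(f has_field_derivative f') (at z)" "f' \<noteq> 0"
  shows "{w. f w = 0} sparse_in UNIV"
proof -
  have "\<not> y islimpt {w. f w = 0}" for y
  proof
    assume "y islimpt {w. f w = 0}"
    then have "f w = 0" for w
      using analytic_continuation[OF hol open_UNIV connected_UNIV subset_UNIV UNIV_I] by blast
    then have "f = (\<lambda>_. 0)" by blast
    then have "(f has_field_derivative 0) (at z)" by simp
    then show False using assms(2,3) DERIV_unique by blast
  qed
  then show ?thesis
    by (simp add: sparse_in_open)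
qed

section \<open>The Webster system\<close>

text \<open>
  The Webster horn equation as a first-order system for the pressure \<open>u\<close> and the flux
  \<open>v = r\<^sup>2 u'\<close>. Its coefficients are continuous even where the Schroedinger potential is merely
  integrable.
\<close>

definition horn_system ::
    "real \<Rightarrow> (real \<Rightarrow> real) \<Rightarrow> complex \<Rightarrow> (real \<Rightarrow> complex) \<Rightarrow> (real \<Rightarrow> complex) \<Rightarrow> bool" where
  "horn_system l r k u v \<longleftrightarrow>
     (\<forall>x\<in>{0..l}. (u has_vector_derivative v x / of_real ((r x)\<^sup>2)) (at x within {0..l}) \<and>
                 (v has_vector_derivative - k\<^sup>2 * of_real ((r x)\<^sup>2) * u x) (at x within {0..l}))"

lemma horn_systemD:
  assumes "horn_system l r k u v" "x \<in> {0..l}"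
  shows "(u has_vector_derivative v x / of_real ((r x)\<^sup>2)) (at x within {0..l})"
    and "(v has_vector_derivative - k\<^sup>2 * of_real ((r x)\<^sup>2) * u x) (at x within {0..l})"
  using assms by (auto simp: horn_system_def)

lemma horn_system_lincomb:
  assumes "horn_system l r k u v" "horn_system l r k u' v'"
  shows "horn_system l r k (\<lambda>x. a * u x + b * u' x) (\<lambda>x. a * v x + b * v' x)"
  unfolding horn_system_def
proof (intro ballI conjI)
  fix x assume x: "x \<in> {0..l}"
  note d = assms[THEN horn_systemD(1), OF x] assms[THEN horn_systemD(2), OF x]
  show "((\<lambda>x. a * u x + b * u' x) has_vector_derivative (a * v x + b * v' x) / of_real ((r x)\<^sup>2))
      (at x within {0..l})"
    using has_vector_derivative_add[OF has_vector_derivative_mult_right[OF d(1), of a]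
        has_vector_derivative_mult_right[OF d(2), of b]]
    by (simp add: add_divide_distrib)
  show "((\<lambda>x. a * v x + b * v' x) has_vector_derivative - k\<^sup>2 * of_real ((r x)\<^sup>2) * (a * u x + b * u' x))
      (at x within {0..l})"
    using has_vector_derivative_add[OF has_vector_derivative_mult_right[OF d(3), of a]
        has_vector_derivative_mult_right[OF d(4), of b]]
    by (simp add: algebra_simps)
qed

text \<open>In the derivative the products of \<open>v\<close> and \<open>v'\<close> cancel, and so
  do those of \<open>u\<close> and \<open>u'\<close>, because both pairs belong to the same
  \<open>k\<close>.\<close>

lemma horn_wronskian_constant:
  assumes "horn_system l r k u v" "horn_system l r k u' v'"
    and "x \<in> {0..l}" "y \<in> {0..l}"
  shows "u x * v' x - v x * u' x = u y * v' y - v y * u' y"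
proof (rule has_vector_derivative_0_constant[where f = "\<lambda>x. u x * v' x - v x * u' x"])
  fix x assume x: "x \<in> {0..l}"
  note d = assms(1,2)[THEN horn_systemD(1), OF x] assms(1,2)[THEN horn_systemD(2), OF x]
  show "((\<lambda>x. u x * v' x - v x * u' x) has_vector_derivative 0) (at x within {0..l})"
    using has_vector_derivative_diff[OF has_vector_derivative_mult[OF d(1) d(4)]
        has_vector_derivative_mult[OF d(3) d(2)]]
    by (simp add: algebra_simps)
qed (use assms in auto)

section \<open>Fundamental solutions of the Webster system\<close>

locale horn =
  fixes l :: real and r r2 :: "real \<Rightarrow> real"
  assumes l_pos: "l > 0" and class_A: "class_A l r r2"
begin

abbreviation "r' \<equiv> D l r"

lemma r_pos: "x \<in> {0..l} \<Longrightarrow> r x > 0"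
  using class_A by (simp add: class_A_def)

lemma r_deriv: "x \<in> {0..l} \<Longrightarrow> (r has_vector_derivative r' x) (at x within {0..l})"
  using class_A by (auto simp: class_A_def intro: D_has_vector_derivative)

lemma r'_cont: "continuous_on {0..l} r'"
  using class_A by (simp add: class_A_def)

lemma r'_ac: "ac_deriv l r' r2"
  using class_A by (simp add: class_A_def)

lemma r_cont: "continuous_on {0..l} r"
  using r_deriv continuous_on_vector_derivative by blast

lemma r_deriv_complex:
  "x \<in> {0..l} \<Longrightarrow> ((\<lambda>x. complex_of_real (r x)) has_vector_derivative of_real (r' x)) (at x within {0..l})"
  using r_deriv by (simp add: has_vector_derivative_of_real has_real_derivative_iff_has_vector_derivative)

lemma endpoints: "0 \<in> {0..l}" "l \<in> {0..l}"
  using l_pos by auto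

text \<open>Both pairs come from the power series with parameter \<open>- k\<^sup>2\<close>: the two
  weights built from \<open>r\<close> give the first pair and, with their roles swapped, the second.
  Holomorphy in \<open>k\<close> is recorded for the first pair, through which \<open>G\<close> will
  be expressed.\<close>

lemma horn_basis:
  obtains u1 v1 u2 v2 :: "complex \<Rightarrow> real \<Rightarrow> complex" where
    "\<And>k. horn_system l r k (u1 k) (v1 k)" "\<And>k. horn_system l r k (u2 k) (v2 k)"
    "\<And>k. u1 k 0 = 1" "\<And>k. v1 k 0 = 0" "\<And>k. u2 k 0 = 0" "\<And>k. v2 k 0 = 1"
    "\<And>x. x \<in> {0..l} \<Longrightarrow> (\<lambda>k. u1 k x) holomorphic_on UNIV"
    "\<And>x. x \<in> {0..l} \<Longrightarrow> (\<lambda>k. v1 k x) holomorphic_on UNIV"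
proof -
  have c: "continuous_on {0..l} (\<lambda>x. 1 / (r x)\<^sup>2)" "continuous_on {0..l} (\<lambda>x. (r x)\<^sup>2)"
    using r_pos by (auto intro!: continuous_intros r_cont simp: less_imp_neq[symmetric])
  obtain f h where fh: "\<And>w. f w 0 = 1" "\<And>w. h w 0 = 0"
    "\<And>w x. x \<in> {0..l} \<Longrightarrow> (f w has_vector_derivative w * of_real (1 / (r x)\<^sup>2) * h w x) (at x within {0..l})"
    "\<And>w x. x \<in> {0..l} \<Longrightarrow> (h w has_vector_derivative of_real ((r x)\<^sup>2) * f w x) (at x within {0..l})"
    and hol: "\<And>x. x \<in> {0..l} \<Longrightarrow> (\<lambda>w. f w x) holomorphic_on UNIV"
    "\<And>x. x \<in> {0..l} \<Longrightarrow> (\<lambda>w. h w x) holomorphic_on UNIV"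
    using linear_system_power_series[OF c less_imp_le[OF l_pos]] by metis
  obtain f' h' :: "complex \<Rightarrow> real \<Rightarrow> complex" where fh': "\<And>w. f' w 0 = 1" "\<And>w. h' w 0 = 0"
    "\<And>w x. x \<in> {0..l} \<Longrightarrow> (f' w has_vector_derivative w * of_real ((r x)\<^sup>2) * h' w x) (at x within {0..l})"
    "\<And>w x. x \<in> {0..l} \<Longrightarrow> (h' w has_vector_derivative of_real (1 / (r x)\<^sup>2) * f' w x) (at x within {0..l})"
    using linear_system_power_series[OF c(2,1) less_imp_le[OF l_pos]] by metis
  show ?thesis
  proof (rule that[of "\<lambda>k. f (- k\<^sup>2)" "\<lambda>k x. - k\<^sup>2 * h (- k\<^sup>2) x" "\<lambda>k. h' (- k\<^sup>2)" "\<lambda>k. f' (- k\<^sup>2)"])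
    show "horn_system l r k (f (- k\<^sup>2)) (\<lambda>x. - k\<^sup>2 * h (- k\<^sup>2) x)" for k
      unfolding horn_system_def using fh(3)[of _ "- k\<^sup>2"] has_vector_derivative_mult_right[OF fh(4), of _ "- k\<^sup>2" "- k\<^sup>2"]
      by (simp add: mult_ac)
    show "horn_system l r k (h' (- k\<^sup>2)) (f' (- k\<^sup>2))" for k
      unfolding horn_system_def using fh'(3,4)[of _ "- k\<^sup>2"] by simp
    show "(\<lambda>k. f (- k\<^sup>2) x) holomorphic_on UNIV" "(\<lambda>k. - k\<^sup>2 * h (- k\<^sup>2) x) holomorphic_on UNIV"
      if "x \<in> {0..l}" for x
      by (intro holomorphic_intros holomorphic_on_compose_gen[OF _ hol(1)[OF that], unfolded o_def]
          holomorphic_on_compose_gen[OF _ hol(2)[OF that], unfolded o_def]; simp)+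
  qed (simp_all add: fh fh')
qed

text \<open>The difference vanishes at \<open>x0\<close>, so its Wronskians with both basis pairs
  vanish everywhere. The basis has Wronskian 1, hence these two linear equations at \<open>x\<close>
  force both components to be 0.\<close>

lemma horn_system_unique:
  assumes "horn_system l r k u v" "horn_system l r k u' v'" "x0 \<in> {0..l}"
    and eq: "u x0 = u' x0" "v x0 = v' x0" and x: "x \<in> {0..l}"
  shows "u x = u' x" and "v x = v' x"
proof -
  obtain u1 v1 u2 v2 where 1: "horn_system l r k u1 v1" and 2: "horn_system l r k u2 v2"
    and init: "u1 0 = 1" "v1 0 = 0" "u2 0 = 0" "v2 0 = 1"
    using horn_basis by metis
  define p where "p x = 1 * u x + (-1) * u' x" for x
  define q where "q x = 1 * v x + (-1) * v' x" for x
  have pq: "horn_system l r k p q"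
    unfolding p_def q_def using assms(1,2) by (rule horn_system_lincomb)
  have det: "u1 x * v2 x - v1 x * u2 x = 1"
    using horn_wronskian_constant[OF 1 2 x endpoints(1)] init by simp
  have zero: "p x0 = 0" "q x0 = 0"
    using eq by (simp_all add: p_def q_def)
  have w: "p x * v1 x - q x * u1 x = 0" "p x * v2 x - q x * u2 x = 0"
    using horn_wronskian_constant[OF pq 1 x assms(3)] horn_wronskian_constant[OF pq 2 x assms(3)]
    by (simp_all add: zero)
  have "p x = (u1 x * v2 x - v1 x * u2 x) * p x"
    by (simp add: det)
  also have "\<dots> = u1 x * (p x * v2 x - q x * u2 x) - u2 x * (p x * v1 x - q x * u1 x)"
    by (simp add: algebra_simps)
  finally have "p x = 0" by (simp add: w)
  have "q x = (u1 x * v2 x - v1 x * u2 x) * q x"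
    by (simp add: det)
  also have "\<dots> = v1 x * (p x * v2 x - q x * u2 x) - v2 x * (p x * v1 x - q x * u1 x)"
    by (simp add: algebra_simps)
  finally have "q x = 0" by (simp add: w)
  show "u x = u' x" "v x = v' x"
    using \<open>p x = 0\<close> \<open>q x = 0\<close> by (simp_all add: p_def q_def)
qed

lemma horn_system_exists:
  assumes "x0 \<in> {0..l}"
  obtains u v where "horn_system l r k u v" "u x0 = a" "v x0 = b"
proof -
  obtain u1 v1 u2 v2 where 1: "horn_system l r k u1 v1" and 2: "horn_system l r k u2 v2"
    and init: "u1 0 = 1" "v1 0 = 0" "u2 0 = 0" "v2 0 = 1"
    using horn_basis by metis
  have det: "u1 x0 * v2 x0 - v1 x0 * u2 x0 = 1"
    using horn_wronskian_constant[OF 1 2 assms endpoints(1)] init by simp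
  \<comment> \<open>Cramer's rule for the values prescribed at \<open>x0\<close>; the determinant is
    1.\<close>
  define s where "s = a * v2 x0 - b * u2 x0"
  define t where "t = u1 x0 * b - v1 x0 * a"
  have "s * u1 x0 + t * u2 x0 = a * (u1 x0 * v2 x0 - v1 x0 * u2 x0)"
    "s * v1 x0 + t * v2 x0 = b * (u1 x0 * v2 x0 - v1 x0 * u2 x0)"
    by (simp_all add: s_def t_def algebra_simps)
  then show ?thesis
    using that[OF horn_system_lincomb[OF 1 2, of s t]] by (simp add: det)
qed

section \<open>Equivalence with the Schroedinger equation\<close>

text \<open>In the derivative of \<open>r \<psi>' - r' \<psi>\<close> the terms
  \<open>r' \<psi>'\<close> cancel, and the rest, \<open>r \<psi>'' - r'' \<psi>\<close>, equals
  \<open>- k\<^sup>2 r \<psi>\<close> almost everywhere. The potential has disappeared and the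
  right-hand side is continuous, hence the equation holds at every point.\<close>

lemma schroedinger_imp_horn_system:
  assumes "schroedinger_solution l (potential r r2) k \<psi>"
  shows "horn_system l r k (\<lambda>x. \<psi> x / of_real (r x))
           (\<lambda>x. of_real (r x) * D l \<psi> x - of_real (r' x) * \<psi> x)"
proof -
  let ?r = "\<lambda>x. complex_of_real (r x)" and ?r' = "\<lambda>x. complex_of_real (r' x)"
  let ?v = "\<lambda>x. ?r x * D l \<psi> x - ?r' x * \<psi> x"
  obtain \<psi>2 where diff: "\<psi> differentiable_on {0..l}" and ac: "ac_deriv l (D l \<psi>) \<psi>2"
    and ae: "AE x in lebesgue_on {0<..<l}. - \<psi>2 x + of_real (potential r r2 x) * \<psi> x = k\<^sup>2 * \<psi> x"
    using assms by (auto simp: schroedinger_solution_def)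
  have \<psi>_deriv: "(\<psi> has_vector_derivative D l \<psi> x) (at x within {0..l})" if "x \<in> {0..l}" for x
    using D_has_vector_derivative[OF diff that] .
  have \<psi>_cont: "continuous_on {0..l} \<psi>"
    using diff by (rule differentiable_imp_continuous_on)
  have ac_\<psi>: "ac_deriv l \<psi> (D l \<psi>)"
    using \<psi>_deriv ac_deriv_continuous_on[OF ac] by (rule ac_derivI_C1)
  have ac_r: "ac_deriv l ?r ?r'"
    using r_deriv_complex continuous_on_of_real[OF r'_cont] by (rule ac_derivI_C1)
  have ac_r': "ac_deriv l ?r' (\<lambda>x. of_real (r2 x))"
    using r'_ac by (rule ac_deriv_of_real)
  have ac_v: "ac_deriv l ?v (\<lambda>x. (?r' x * D l \<psi> x + ?r x * \<psi>2 x) - (of_real (r2 x) * \<psi> x + ?r' x * D l \<psi> x))"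
    by (intro ac_deriv_diff ac_deriv_mult ac_r ac ac_r' ac_\<psi>)
  obtain N where N: "negligible N"
    and eq: "\<And>x. x \<in> {0..l} - N \<Longrightarrow> - \<psi>2 x + of_real (potential r r2 x) * \<psi> x = k\<^sup>2 * \<psi> x"
    using AE_open_interval_negligible[OF ae] by blast
  have "ac_deriv l ?v (\<lambda>x. - k\<^sup>2 * ?r x * \<psi> x)"
    using ac_v N
  proof (rule ac_deriv_spike)
    fix x assume x: "x \<in> {0..l} - N"
    then have "\<psi>2 x = of_real (r2 x) / ?r x * \<psi> x - k\<^sup>2 * \<psi> x"
      using eq[OF x] by (simp add: potential_def algebra_simps)
    then show "- k\<^sup>2 * ?r x * \<psi> x
        = (?r' x * D l \<psi> x + ?r x * \<psi>2 x) - (of_real (r2 x) * \<psi> x + ?r' x * D l \<psi> x)"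
      using r_pos[of x] x by (simp add: field_simps)
  qed
  then have v_deriv: "(?v has_vector_derivative - k\<^sup>2 * ?r x * \<psi> x) (at x within {0..l})" if "x \<in> {0..l}" for x
    by (rule ac_deriv_continuous_has_vector_derivative[OF _ _ that])
      (intro continuous_intros \<psi>_cont continuous_on_of_real r_cont)
  show ?thesis
    unfolding horn_system_def
  proof (intro ballI conjI)
    fix x assume x: "x \<in> {0..l}"
    have rx: "?r x \<noteq> 0" using r_pos[OF x] by simp
    show "((\<lambda>x. \<psi> x / ?r x) has_vector_derivative ?v x / of_real ((r x)\<^sup>2)) (at x within {0..l})"
      using has_vector_derivative_quotient[OF \<psi>_deriv[OF x] r_deriv_complex[OF x] rx]
      by (simp add: mult.commute)
    show "(?v has_vector_derivative - k\<^sup>2 * of_real ((r x)\<^sup>2) * (\<psi> x / ?r x)) (at x within {0..l})"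
      using v_deriv[OF x] rx by (simp add: power2_eq_square mult.assoc)
  qed
qed

text \<open>When \<open>\<psi>' = r' u + v / r\<close> is differentiated, the two terms
  \<open>r' v / r\<^sup>2\<close> cancel, which leaves \<open>r'' u - k\<^sup>2 r u\<close> as an
  integrable representative of the second derivative.\<close>

lemma horn_system_imp_schroedinger:
  assumes uv: "horn_system l r k u v"
  shows "schroedinger_solution l (potential r r2) k (\<lambda>x. of_real (r x) * u x)"
    and "x \<in> {0..l} \<Longrightarrow> D l (\<lambda>x. of_real (r x) * u x) x = of_real (r' x) * u x + v x / of_real (r x)"
proof -
  let ?r = "\<lambda>x. complex_of_real (r x)" and ?r' = "\<lambda>x. complex_of_real (r' x)"
  let ?\<psi> = "\<lambda>x. ?r x * u x"
  have r0: "?r x \<noteq> 0" if "x \<in> {0..l}" for x using r_pos[OF that] by simp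
  have u': "(u has_vector_derivative v x / (?r x)\<^sup>2) (at x within {0..l})"
    and v': "(v has_vector_derivative - k\<^sup>2 * (?r x)\<^sup>2 * u x) (at x within {0..l})" if "x \<in> {0..l}" for x
    using horn_systemD[OF uv that] by simp_all
  have cu: "continuous_on {0..l} u"
    using u' by (rule continuous_on_vector_derivative)
  have cv: "continuous_on {0..l} v"
    using v' by (rule continuous_on_vector_derivative)
  have cr: "continuous_on {0..l} ?r" and cr': "continuous_on {0..l} ?r'"
    using r_cont r'_cont by (auto intro: continuous_on_of_real)
  have \<psi>': "(?\<psi> has_vector_derivative ?r' x * u x + v x / ?r x) (at x within {0..l})" if x: "x \<in> {0..l}" for x
    using has_vector_derivative_mult[OF r_deriv_complex[OF x] u'[OF x]] r0[OF x]
    by (simp add: power2_eq_square add.commute)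
  show D\<psi>: "D l ?\<psi> x = ?r' x * u x + v x / ?r x" if "x \<in> {0..l}" for x
    using D_eqI[OF l_pos that \<psi>'[OF that]] .
  have ac_u: "ac_deriv l u (\<lambda>x. v x / (?r x)\<^sup>2)"
    by (rule ac_derivI_C1[OF u'], assumption, intro continuous_intros cv cr) (use r0 in auto)
  have ac_q: "ac_deriv l (\<lambda>x. v x / ?r x) (\<lambda>x. - k\<^sup>2 * ?r x * u x - v x * ?r' x / (?r x)\<^sup>2)"
  proof (rule ac_derivI_C1)
    fix x assume x: "x \<in> {0..l}"
    show "((\<lambda>x. v x / ?r x) has_vector_derivative - k\<^sup>2 * ?r x * u x - v x * ?r' x / (?r x)\<^sup>2) (at x within {0..l})"
      using has_vector_derivative_quotient[OF v'[OF x] r_deriv_complex[OF x] r0[OF x]] r0[OF x]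
      by (simp add: field_simps power2_eq_square)
  qed (intro continuous_intros cv cr cr' cu, use r0 in auto)
  have ac_r': "ac_deriv l ?r' (\<lambda>x. of_real (r2 x))"
    using r'_ac by (rule ac_deriv_of_real)
  have "ac_deriv l (\<lambda>x. ?r' x * u x + v x / ?r x)
      (\<lambda>x. (of_real (r2 x) * u x + ?r' x * (v x / (?r x)\<^sup>2)) + (- k\<^sup>2 * ?r x * u x - v x * ?r' x / (?r x)\<^sup>2))"
    by (intro ac_deriv_add ac_deriv_mult ac_r' ac_u ac_q)
  then have "ac_deriv l (D l ?\<psi>) (\<lambda>x. of_real (r2 x) * u x - k\<^sup>2 * ?r x * u x)"
    using D\<psi> by (auto simp: algebra_simps intro: ac_deriv_cong)
  moreover have "AE x in lebesgue_on {0<..<l}. - (of_real (r2 x) * u x - k\<^sup>2 * ?r x * u x)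
      + of_real (potential r r2 x) * ?\<psi> x = k\<^sup>2 * ?\<psi> x"
  proof (rule AE_I2)
    fix x assume "x \<in> space (lebesgue_on {0<..<l})"
    then have "?r x \<noteq> 0" by (intro r0) auto
    then show "- (of_real (r2 x) * u x - k\<^sup>2 * ?r x * u x)
      + of_real (potential r r2 x) * ?\<psi> x = k\<^sup>2 * ?\<psi> x"
      by (simp add: potential_def)
  qed
  moreover have "?\<psi> differentiable_on {0..l}"
    using \<psi>' by (rule differentiable_onI_vector)
  ultimately show "schroedinger_solution l (potential r r2) k ?\<psi>"
    unfolding schroedinger_solution_def by blast
qed

text \<open>The choice behind \<open>schroedinger_ivp\<close> is legitimate: data for
  \<open>\<psi>\<close> at \<open>x0\<close> translate into data for the horn system, which is
  solvable from any point of the interval.\<close>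

lemma schroedinger_ivp_spec:
  fixes a b k x0
  defines "\<psi> \<equiv> schroedinger_ivp l (potential r r2) k x0 a b"
  assumes x0: "x0 \<in> {0..l}"
  shows "schroedinger_solution l (potential r r2) k \<psi>" "\<psi> x0 = a" "D l \<psi> x0 = b"
proof -
  have r0: "complex_of_real (r x0) \<noteq> 0" using r_pos[OF x0] by simp
  obtain u v where uv: "horn_system l r k u v" "u x0 = a / of_real (r x0)"
    "v x0 = of_real (r x0) * b - of_real (r' x0) * a"
    using horn_system_exists[OF x0] by blast
  have "D l (\<lambda>x. of_real (r x) * u x) x0 = b" "of_real (r x0) * u x0 = a"
    using horn_system_imp_schroedinger(2)[OF uv(1) x0] uv(2,3) r0 by (simp_all add: field_simps)
  then have "\<exists>\<psi>. schroedinger_solution l (potential r r2) k \<psi> \<and> \<psi> x0 = a \<and> D l \<psi> x0 = b"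
    using horn_system_imp_schroedinger(1)[OF uv(1)] by blast
  from someI_ex[OF this]
  show "schroedinger_solution l (potential r r2) k \<psi>" "\<psi> x0 = a" "D l \<psi> x0 = b"
    by (auto simp: \<psi>_def schroedinger_ivp_def)
qed

section \<open>Passage between the pressure equation and the system\<close>

text \<open>The equation is given only inside the interval and says nothing about
  \<open>D l P\<close> at the ends. A continuous \<open>w\<close>, defined by integration, agrees
  with the flux inside; then \<open>P\<close> differs by a constant from the integral
  \<open>Q\<close> of \<open>w / r\<^sup>2\<close>, which identifies its one-sided derivatives at
  the ends too.\<close>

lemma pressure_imp_horn_system:
  assumes diff: "P differentiable_on {0..l}"
    and eq: "\<forall>x\<in>{0<..<l}. \<exists>d.
        ((\<lambda>y. of_real ((r y)\<^sup>2) * D l P y) has_vector_derivative d) (at x) \<and>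
        d + k\<^sup>2 * of_real ((r x)\<^sup>2) * P x = 0"
  shows "horn_system l r k P (\<lambda>x. of_real ((r x)\<^sup>2) * D l P x)"
proof -
  let ?\<rho> = "\<lambda>x. complex_of_real ((r x)\<^sup>2)"
  let ?v = "\<lambda>x. ?\<rho> x * D l P x"
  have \<rho>0: "?\<rho> x \<noteq> 0" if "x \<in> {0..l}" for x using r_pos[OF that] by simp
  have c\<rho>: "continuous_on {0..l} ?\<rho>"
    by (intro continuous_on_of_real continuous_on_power r_cont)
  have cP: "continuous_on {0..l} P"
    using diff by (rule differentiable_imp_continuous_on)
  have DP: "(P has_vector_derivative D l P x) (at x within {0..l})" if "x \<in> {0..l}" for x
    using diff that by (rule D_has_vector_derivative)
  have v': "(?v has_vector_derivative - k\<^sup>2 * ?\<rho> x * P x) (at x)" if "x \<in> {0<..<l}" for x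
  proof -
    obtain d where "(?v has_vector_derivative d) (at x)" "d + k\<^sup>2 * ?\<rho> x * P x = 0"
      using eq \<open>x \<in> {0<..<l}\<close> by blast
    moreover from this(2) have "d = - k\<^sup>2 * ?\<rho> x * P x"
      by (simp add: eq_neg_iff_add_eq_0)
    ultimately show ?thesis by simp
  qed
  define J where "J x = integral {0..x} (\<lambda>t. - k\<^sup>2 * ?\<rho> t * P t)" for x
  \<comment> \<open>The midpoint serves as base point because the flux is known to be differentiable
    only inside the interval.\<close>
  define w where "w x = ?v (l / 2) - J (l / 2) + J x" for x
  have w': "(w has_vector_derivative - k\<^sup>2 * ?\<rho> x * P x) (at x within {0..l})" if "x \<in> {0..l}" for x
  proof -
    have "(J has_vector_derivative - k\<^sup>2 * ?\<rho> x * P x) (at x within {0..l})"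
      unfolding J_def using that
      by (intro integral_has_vector_derivative continuous_intros c\<rho> cP)
    then show ?thesis
      unfolding w_def by (auto intro!: derivative_eq_intros)
  qed
  have vw: "?v x = w x" if x: "x \<in> {0<..<l}" for x
  proof -
    have "?v x - w x = ?v (l / 2) - w (l / 2)"
    proof (rule has_vector_derivative_0_constant[where f = "\<lambda>x. ?v x - w x" and S = "{0<..<l}"])
      fix x assume x: "x \<in> {0<..<l}"
      then have "(w has_vector_derivative - k\<^sup>2 * ?\<rho> x * P x) (at x within {0<..<l})"
        by (intro has_vector_derivative_within_subset[OF w']) auto
      from has_vector_derivative_diff[OF has_vector_derivative_at_within[OF v'[OF x]] this]
      show "((\<lambda>x. ?v x - w x) has_vector_derivative 0) (at x within {0<..<l})" by simp
    qed (use x l_pos in auto)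
    also have "\<dots> = 0" by (simp add: w_def)
    finally show ?thesis by simp
  qed
  have cw: "continuous_on {0..l} w"
    using w' by (rule continuous_on_vector_derivative)
  define Q where "Q x = integral {0..x} (\<lambda>t. w t / ?\<rho> t)" for x
  have Q': "(Q has_vector_derivative w x / ?\<rho> x) (at x within {0..l})" if "x \<in> {0..l}" for x
    unfolding Q_def using that
    by (intro integral_has_vector_derivative continuous_intros c\<rho> cw) (use \<rho>0 in auto)
  \<comment> \<open>The derivatives agree inside the interval; continuity of \<open>P\<close> and
    \<open>Q\<close> takes care of the two exceptional endpoints.\<close>
  have PQ: "P x - Q x = P 0 - Q 0" if x: "x \<in> {0..l}" for x
  proof (rule has_derivative_zero_unique_strong_interval[where f = "\<lambda>x. P x - Q x" and k = "{0, l}"])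
    show "continuous_on {0..l} (\<lambda>x. P x - Q x)"
      using Q' by (intro continuous_on_diff cP continuous_on_vector_derivative)
    fix x assume x: "x \<in> {0..l} - {0, l}"
    then have "D l P x - w x / ?\<rho> x = 0"
      using vw[of x] \<rho>0[of x] by (auto simp: field_simps)
    then have "((\<lambda>x. P x - Q x) has_vector_derivative 0) (at x within {0..l})"
      using has_vector_derivative_diff[OF DP Q', of x] x by auto
    then show "((\<lambda>x. P x - Q x) has_derivative (\<lambda>h. 0)) (at x within {0..l})"
      by (simp add: has_vector_derivative_def)
  qed (use x in auto)
  have P': "(P has_vector_derivative w x / ?\<rho> x) (at x within {0..l})" if x: "x \<in> {0..l}" for x
  proof (rule has_vector_derivative_transform[OF x])
    show "((\<lambda>x. P 0 - Q 0 + Q x) has_vector_derivative w x / ?\<rho> x) (at x within {0..l})"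
      using has_vector_derivative_add[OF has_vector_derivative_const Q'[OF x], of "P 0 - Q 0"] by simp
    show "P y = P 0 - Q 0 + Q y" if "y \<in> {0..l}" for y
      using PQ[OF that] by (simp add: algebra_simps)
  qed
  have v_eq: "?v x = w x" if "x \<in> {0..l}" for x
    using D_eqI[OF l_pos that P'[OF that]] \<rho>0[OF that] by simp
  show ?thesis
    unfolding horn_system_def
  proof (intro ballI conjI)
    fix x assume x: "x \<in> {0..l}"
    show "(P has_vector_derivative ?v x / ?\<rho> x) (at x within {0..l})"
      using P'[OF x] by (simp only: v_eq[OF x])
    show "(?v has_vector_derivative - k\<^sup>2 * ?\<rho> x * P x) (at x within {0..l})"
      by (rule has_vector_derivative_transform[OF x v_eq w'[OF x]])
  qed
qed

lemma horn_system_imp_pressure: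
  assumes uv: "horn_system l r k u v"
  shows "u differentiable_on {0..l}"
    and "x \<in> {0..l} \<Longrightarrow> D l u x = v x / of_real ((r x)\<^sup>2)"
    and "\<forall>x\<in>{0<..<l}. \<exists>d.
        ((\<lambda>y. of_real ((r y)\<^sup>2) * D l u y) has_vector_derivative d) (at x) \<and>
        d + k\<^sup>2 * of_real ((r x)\<^sup>2) * u x = 0"
proof -
  show "u differentiable_on {0..l}"
    using horn_systemD(1)[OF uv] by (rule differentiable_onI_vector)
  show Du: "D l u x = v x / of_real ((r x)\<^sup>2)" if "x \<in> {0..l}" for x
    using D_eqI[OF l_pos that horn_systemD(1)[OF uv that]] .
  show "\<forall>x\<in>{0<..<l}. \<exists>d.
        ((\<lambda>y. of_real ((r y)\<^sup>2) * D l u y) has_vector_derivative d) (at x) \<and>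
        d + k\<^sup>2 * of_real ((r x)\<^sup>2) * u x = 0"
  proof (intro ballI exI conjI)
    fix x assume x: "x \<in> {0<..<l}"
    then have "x \<in> {0..l}" by simp
    from has_vector_derivative_within_subset[OF horn_systemD(2)[OF uv this]]
    have "(v has_vector_derivative - k\<^sup>2 * of_real ((r x)\<^sup>2) * u x) (at x within {0<..<l})"
      by (simp add: greaterThanLessThan_subseteq_atLeastAtMost_iff)
    then have v': "(v has_vector_derivative - k\<^sup>2 * of_real ((r x)\<^sup>2) * u x) (at x)"
      unfolding at_within_open[OF x open_greaterThanLessThan] .
    show "((\<lambda>y. of_real ((r y)\<^sup>2) * D l u y) has_vector_derivative - k\<^sup>2 * of_real ((r x)\<^sup>2) * u x) (at x)"
    proof (rule has_vector_derivative_transform_within_open[OF v' _ x])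
      fix y assume "y \<in> {0<..<l}"
      then have y: "y \<in> {0..l}" by auto
      then show "v y = of_real ((r y)\<^sup>2) * D l u y"
        using Du[OF y] r_pos[OF y] by simp
    qed simp
  qed simp
qed

text \<open>The terms with \<open>r'\<close> cancel, so the Wronskian of the associated horn pairs
  is the usual Wronskian of \<open>\<psi>\<close> and \<open>\<eta>\<close>.\<close>

lemma schroedinger_wronskian_constant:
  assumes \<psi>: "schroedinger_solution l (potential r r2) k \<psi>"
    and \<eta>: "schroedinger_solution l (potential r r2) k \<eta>"
    and x: "x \<in> {0..l}" and y: "y \<in> {0..l}"
  shows "\<psi> x * D l \<eta> x - D l \<psi> x * \<eta> x = \<psi> y * D l \<eta> y - D l \<psi> y * \<eta> y"
proof -
  have "\<psi> x / of_real (r x) * (of_real (r x) * D l \<eta> x - of_real (r' x) * \<eta> x)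
      - (of_real (r x) * D l \<psi> x - of_real (r' x) * \<psi> x) * (\<eta> x / of_real (r x))
      = \<psi> x * D l \<eta> x - D l \<psi> x * \<eta> x" if "x \<in> {0..l}" for x
    using r_pos[OF that] by (simp add: field_simps)
  from this[OF x] this[OF y] show ?thesis
    using horn_wronskian_constant[OF schroedinger_imp_horn_system[OF \<psi>]
        schroedinger_imp_horn_system[OF \<eta>] x y] by simp
qed

section \<open>The Wronskian \<open>G\<close> and its zeros\<close>

abbreviation "S \<equiv> sol_S l r r2"
abbreviation "\<phi> \<equiv> sol_phi l r r2"
abbreviation "g \<equiv> sol_g l r r2"
abbreviation "G \<equiv> wronskian_G l r r2"
abbreviation "z \<equiv> impedance (r l)"

lemmas S_spec = schroedinger_ivp_spec[OF endpoints(1), of _ 0 1, folded sol_S_def]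
lemmas \<phi>_spec = schroedinger_ivp_spec[OF endpoints(1), of _ 1 "of_real (r' 0 / r 0)", folded sol_phi_def]
lemmas g_spec = schroedinger_ivp_spec[OF endpoints(2), of k "z k" "of_real (r' l / r l) * z k - \<i> * k" for k,
    folded sol_g_def]

text \<open>Constancy of the Wronskian makes the definite description meaningful and lets
  \<open>G\<close> be evaluated at whichever endpoint is convenient.\<close>

lemma G_eq:
  assumes "x \<in> {0..l}"
  shows "G k = \<phi> k x * D l (g k) x - D l (\<phi> k) x * g k x"
  unfolding wronskian_G_def
proof (rule the_equality)
  show "\<forall>y\<in>{0..l}. \<phi> k x * D l (g k) x - D l (\<phi> k) x * g k x
      = \<phi> k y * D l (g k) y - D l (\<phi> k) y * g k y"
    using schroedinger_wronskian_constant[OF \<phi>_spec(1) g_spec(1) assms] by blast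
qed (use assms in blast)

lemma r0_nz: "complex_of_real (r 0) \<noteq> 0" and rl_nz: "complex_of_real (r l) \<noteq> 0"
  using r_pos[OF endpoints(1)] r_pos[OF endpoints(2)] by simp_all

text \<open>The horn pair of \<open>\<phi>\<close> has the values \<open>1 / r 0\<close> and 0 at 0,
  so \<open>r 0\<close> times it is the basis pair whose values are entire in \<open>k\<close>.
  Evaluation at \<open>l\<close> makes \<open>G\<close> a nonzero constant multiple of the entire
  function \<open>f\<close>.\<close>

lemma G_zeros_sparse: "{k. G k = 0} sparse_in UNIV"
proof -
  obtain u1 v1 where uv: "\<And>k. horn_system l r k (u1 k) (v1 k)"
    and init: "\<And>k. u1 k 0 = 1" "\<And>k. v1 k 0 = 0"
    and hol: "(\<lambda>k. u1 k l) holomorphic_on UNIV" "(\<lambda>k. v1 k l) holomorphic_on UNIV"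
    using horn_basis endpoints(2) by metis
  obtain d where z: "d \<noteq> 0" "(z has_field_derivative d) (at 0)" "z 0 = 0" "z holomorphic_on UNIV"
    using impedance_properties[of "r l"] rl_nz by (metis of_real_eq_0_iff)
  define f where "f k = \<i> * k * of_real (r l) * u1 k l + v1 k l * z k / of_real (r l)" for k
  have "of_real (r 0) * G k = - f k" for k
  proof -
    have R: "complex_of_real (r 0) * (of_real (r' 0 / r 0)) = of_real (r' 0)"
      using r0_nz by simp
    \<comment> \<open>The coefficient 0 reduces the rule for linear combinations to scaling by
      \<open>r 0\<close>.\<close>
    have horn: "horn_system l r k (\<lambda>x. 0 * u1 k x + of_real (r 0) * (\<phi> k x / of_real (r x)))
        (\<lambda>x. 0 * v1 k x + of_real (r 0) * (of_real (r x) * D l (\<phi> k) x - of_real (r' x) * \<phi> k x))"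
      by (rule horn_system_lincomb[OF uv schroedinger_imp_horn_system[OF \<phi>_spec(1)]])
    have u: "u1 k l = of_real (r 0) * (\<phi> k l / of_real (r l))"
      and v: "v1 k l = of_real (r 0) * (of_real (r l) * D l (\<phi> k) l - of_real (r' l) * \<phi> k l)"
      using horn_system_unique[OF uv horn endpoints(1) _ _ endpoints(2)] \<phi>_spec(2,3)[of k] r0_nz R
      by (simp_all add: init)
    show ?thesis
      unfolding f_def u v G_eq[OF endpoints(2)] g_spec(2,3) using rl_nz
      by (simp add: field_simps)
  qed
  then have zeros: "{k. G k = 0} = {k. f k = 0}"
    using r0_nz by (metis mult_eq_0_iff neg_equal_0_iff_equal)
  \<comment> \<open>For \<open>k = 0\<close> constant pressure with zero flux has the initial values
    of the first basis pair.\<close>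
  have "horn_system l r 0 (\<lambda>_. 1) (\<lambda>_. 0)"
    by (simp add: horn_system_def)
  from horn_system_unique[OF uv this endpoints(1) _ _ endpoints(2)]
  have at_0: "u1 0 l = 1" "v1 0 l = 0"
    by (simp_all add: init)
  obtain u1' v1' where d1: "((\<lambda>k. u1 k l) has_field_derivative u1') (at 0)"
    "((\<lambda>k. v1 k l) has_field_derivative v1') (at 0)"
    using hol[THEN holomorphic_on_imp_differentiable_at, OF open_UNIV UNIV_I]
    unfolding field_differentiable_def by blast
  \<comment> \<open>Both \<open>v1 0 l\<close> and \<open>z 0\<close> vanish, so the product of
    \<open>v1\<close> and \<open>z\<close> contributes nothing to the derivative at 0.\<close>
  have "(f has_field_derivative \<i> * of_real (r l)) (at 0)"
    unfolding f_def
    by (rule derivative_eq_intros d1 z(2) refl rl_nz | simp add: at_0 z(3))+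
  moreover have "f holomorphic_on UNIV"
    unfolding f_def using rl_nz by (intro holomorphic_intros hol z(4)) auto
  ultimately show ?thesis
    unfolding zeros using rl_nz by (intro sparse_zeros_of_entire) auto
qed

text \<open>
  For \<open>k \<noteq> 0\<close> the condition at the lips says that the Wronskian with the solution \<open>g\<close> vanishes.
\<close>

lemma lip_condition_iff_wronskian:
  assumes "k \<noteq> 0" and uv: "horn_system l r k u v"
  shows "lip_condition (r l) k (u l) (D l u l) \<longleftrightarrow> (of_real (r 0))\<^sup>2 * G k * u 0 = v 0 * g k 0"
proof -
  let ?ug = "\<lambda>x. g k x / of_real (r x)" and ?vg = "\<lambda>x. of_real (r x) * D l (g k) x - of_real (r' x) * g k x"
  have w: "u l * ?vg l - v l * ?ug l = u 0 * ?vg 0 - v 0 * ?ug 0"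
    by (rule horn_wronskian_constant[OF uv schroedinger_imp_horn_system[OF g_spec(1)] endpoints(2,1)])
  \<comment> \<open>The data of \<open>g\<close> at \<open>l\<close> and of \<open>\<phi>\<close> at
    0 are such that the terms with \<open>r'\<close> cancel. Thus the Wronskian of \<open>u\<close>
    and \<open>g / r\<close> becomes the lip condition at \<open>l\<close> and brings in
    \<open>G\<close> at 0.\<close>
  have vg_l: "?vg l = - \<i> * k * of_real (r l)"
    unfolding g_spec(2,3) using rl_nz by (simp add: field_simps)
  have vg_0: "?vg 0 = of_real (r 0) * G k"
    unfolding G_eq[OF endpoints(1)] \<phi>_spec(2,3) using r0_nz by (simp add: field_simps)
  have v_l: "v l = (of_real (r l))\<^sup>2 * D l u l"
    using horn_system_imp_pressure(2)[OF uv endpoints(2)] rl_nz by simp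
  have "- of_real (r l) * (D l u l * z k + \<i> * k * u l)
      = u l * (- \<i> * k * of_real (r l)) - (of_real (r l))\<^sup>2 * D l u l * (z k / of_real (r l))"
    using rl_nz by (simp add: field_simps power2_eq_square)
  also have "\<dots> = u 0 * (of_real (r 0) * G k) - v 0 * (g k 0 / of_real (r 0))"
    using w unfolding vg_l vg_0 v_l by (simp only: g_spec(2))
  finally have "- of_real (r l) * (D l u l * z k + \<i> * k * u l) * of_real (r 0)
      = (of_real (r 0))\<^sup>2 * G k * u 0 - v 0 * g k 0"
    using r0_nz by (simp add: field_simps power2_eq_square)
  then show ?thesis
    unfolding lip_condition_iff[OF \<open>k \<noteq> 0\<close>] using rl_nz r0_nz by auto
qed

section \<open>Existence and uniqueness of the pressure\<close>

definition pressure :: "real \<Rightarrow> real \<Rightarrow> complex \<Rightarrow> real \<Rightarrow> complex" where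
  "pressure c \<mu> k x =
     - (\<i> * k * of_real c * of_real \<mu> / (of_real pi * of_real (r 0) * of_real (r x)))
     * (g k 0 / G k * \<phi> k x + S k x)"

text \<open>At 0 the flux of \<open>\<phi> / r\<close> vanishes and that of \<open>S / r\<close> is
  \<open>r 0\<close>, while \<open>S\<close> itself vanishes. Hence the term with \<open>S\<close>
  provides the prescribed flux and the multiple of \<open>\<phi>\<close> sets the pressure
  there.\<close>

lemma pressure_horn_system:
  obtains v where "horn_system l r k (pressure c \<mu> k) v"
    and "v 0 = - (\<i> * k * of_real c * of_real \<mu> / of_real pi)"
    and "pressure c \<mu> k 0 = v 0 * g k 0 / ((of_real (r 0))\<^sup>2 * G k)"
proof -
  define \<kappa> where "\<kappa> = - (\<i> * k * of_real c * of_real \<mu> / (of_real pi * of_real (r 0)))"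
  define v where "v x = \<kappa> * (g k 0 / G k) * (of_real (r x) * D l (\<phi> k) x - of_real (r' x) * \<phi> k x)
      + \<kappa> * (of_real (r x) * D l (S k) x - of_real (r' x) * S k x)" for x
  have "horn_system l r k (\<lambda>x. \<kappa> * (g k 0 / G k) * (\<phi> k x / of_real (r x)) + \<kappa> * (S k x / of_real (r x))) v"
    unfolding v_def
    by (intro horn_system_lincomb schroedinger_imp_horn_system \<phi>_spec(1) S_spec(1))
  moreover have "(\<lambda>x. \<kappa> * (g k 0 / G k) * (\<phi> k x / of_real (r x)) + \<kappa> * (S k x / of_real (r x)))
      = pressure c \<mu> k"
  proof
    fix x
    have "\<kappa> * q * (a / \<rho>) + \<kappa> * (b / \<rho>) = \<kappa> / \<rho> * (q * a + b)" for q a b \<rho> :: complex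
      by (simp add: distrib_left)
    moreover have "\<kappa> / of_real (r x) = - (\<i> * k * of_real c * of_real \<mu> / (of_real pi * of_real (r 0) * of_real (r x)))"
      by (simp add: \<kappa>_def)
    ultimately show "\<kappa> * (g k 0 / G k) * (\<phi> k x / of_real (r x)) + \<kappa> * (S k x / of_real (r x))
        = pressure c \<mu> k x"
      unfolding pressure_def by (simp only:)
  qed
  ultimately have "horn_system l r k (pressure c \<mu> k) v" by simp
  moreover have v0: "v 0 = \<kappa> * of_real (r 0)"
    unfolding v_def \<phi>_spec(2,3) S_spec(2,3) using r0_nz by simp
  moreover have "pressure c \<mu> k 0 = \<kappa> / of_real (r 0) * (g k 0 / G k)"
    unfolding pressure_def \<kappa>_def \<phi>_spec(2) S_spec(2) by simp
  ultimately show ?thesis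
    using that[of v] r0_nz by (simp add: \<kappa>_def power2_eq_square)
qed

text \<open>For nonzero \<open>k\<close> the coefficient \<open>g k 0 / G k\<close> is what the
  Wronskian form of the lip condition demands of the pressure at 0. At \<open>k = 0\<close>, where
  \<open>G\<close> vanishes, the quotient is 0 by convention and the prefactor makes the whole
  formula 0.\<close>

lemma pressure_solution_exists:
  assumes "k = 0 \<or> G k \<noteq> 0"
  shows "pressure_solution l r c \<mu> k (pressure c \<mu> k)"
proof -
  obtain v where v: "horn_system l r k (pressure c \<mu> k) v"
    and v0: "v 0 = - (\<i> * k * of_real c * of_real \<mu> / of_real pi)"
    and p0: "pressure c \<mu> k 0 = v 0 * g k 0 / ((of_real (r 0))\<^sup>2 * G k)"
    using pressure_horn_system by metis
  note p = horn_system_imp_pressure[OF v]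
  have "D l (pressure c \<mu> k) 0 = - (\<i> * k * of_real c * of_real \<mu> / (of_real pi * of_real ((r 0)\<^sup>2)))"
    using p(2)[OF endpoints(1)] v0 by simp
  moreover have "lip_condition (r l) k (pressure c \<mu> k l) (D l (pressure c \<mu> k) l)"
  proof (cases "k = 0")
    case True
    then have "pressure c \<mu> k = (\<lambda>_. 0)" by (simp add: pressure_def fun_eq_iff)
    moreover from this have "D l (pressure c \<mu> k) l = 0"
      using D_eqI[OF l_pos endpoints(2) has_vector_derivative_const] by simp
    ultimately show ?thesis
      using True lip_condition_0[of "r l"] rl_nz by simp
  next
    case False
    then show ?thesis
      unfolding lip_condition_iff_wronskian[OF False v] p0 using assms r0_nz by simp
  qed
  ultimately show ?thesis
    using p(1,3) by (simp add: pressure_solution_def)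
qed

text \<open>The flux at 0 is prescribed and, when \<open>G k\<close> is nonzero, the Wronskian form
  of the lip condition fixes \<open>P 0\<close>. Two solutions therefore share their initial
  values.\<close>

lemma pressure_solution_unique:
  assumes "k = 0 \<or> G k \<noteq> 0" and P: "pressure_solution l r c \<mu> k P" and x: "x \<in> {0..l}"
  shows "P x = pressure c \<mu> k x"
proof -
  define w where "w x = of_real ((r x)\<^sup>2) * D l P x" for x
  have w: "horn_system l r k P w"
    using P unfolding pressure_solution_def w_def by (intro pressure_imp_horn_system) auto
  have w0: "w 0 = - (\<i> * k * of_real c * of_real \<mu> / of_real pi)"
    using P r0_nz by (simp add: pressure_solution_def w_def)
  have lip: "lip_condition (r l) k (P l) (D l P l)"
    using P by (simp add: pressure_solution_def)
  show ?thesis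
  proof (cases "k = 0")
    case True
    \<comment> \<open>For \<open>k = 0\<close> the prescribed flux is 0, so \<open>P\<close> is
      constant, and the lip condition makes the constant 0.\<close>
    have "horn_system l r k (\<lambda>_. P 0) (\<lambda>_. 0)"
      using True by (simp add: horn_system_def)
    then have const: "P x = P 0" "w x = 0" if "x \<in> {0..l}" for x
      using horn_system_unique[OF w _ endpoints(1) _ _ that] w0 True by auto
    have "D l P l = 0"
      using const(2)[OF endpoints(2)] rl_nz by (simp add: w_def)
    then have "P l = 0"
      using lip lip_condition_0[of "r l"] rl_nz True by simp
    then show ?thesis
      using const(1)[OF x] const(1)[OF endpoints(2)] True by (simp add: pressure_def)
  next
    case False
    with assms have G: "G k \<noteq> 0" by simp
    obtain v where v: "horn_system l r k (pressure c \<mu> k) v"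
      and v0: "v 0 = - (\<i> * k * of_real c * of_real \<mu> / of_real pi)"
      and p0: "pressure c \<mu> k 0 = v 0 * g k 0 / ((of_real (r 0))\<^sup>2 * G k)"
      using pressure_horn_system by metis
    have "(of_real (r 0))\<^sup>2 * G k * P 0 = w 0 * g k 0"
      using lip lip_condition_iff_wronskian[OF False w] by simp
    then have "P 0 = pressure c \<mu> k 0"
      unfolding p0 v0 w0 using G r0_nz by (simp add: field_simps)
    then show ?thesis
      using horn_system_unique(1)[OF w v endpoints(1) _ _ x] w0 v0 by simp
  qed
qed

end

theorem theorem5p1:
  fixes l c \<mu> :: real and r r2 :: "real \<Rightarrow> real"
  assumes "l > 0" and "c > 0" and "\<mu> > 0"
    and "class_A l r r2"
  shows "{k. wronskian_G l r r2 k = 0} sparse_in UNIV \<and>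
    (\<forall>k::complex. k = 0 \<or> wronskian_G l r r2 k \<noteq> 0 \<longrightarrow>
       (\<exists>P. pressure_solution l r c \<mu> k P) \<and>
       (\<forall>P Q. pressure_solution l r c \<mu> k P \<longrightarrow> pressure_solution l r c \<mu> k Q \<longrightarrow>
          (\<forall>x\<in>{0..l}. P x = Q x)) \<and>
       (\<forall>P. pressure_solution l r c \<mu> k P \<longrightarrow>
          (\<forall>x\<in>{0..l}. P x =
             - (\<i> * k * of_real c * of_real \<mu> / (of_real pi * of_real (r 0) * of_real (r x)))
             * (sol_g l r r2 k 0 / wronskian_G l r r2 k * sol_phi l r r2 k x
                + sol_S l r r2 k x))))"
proof -
  interpret horn l r r2
    using assms by unfold_locales
  show ?thesis
  proof (intro conjI allI impI ballI)
    show "{k. G k = 0} sparse_in UNIV"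
      by (rule G_zeros_sparse)
    fix k :: complex
    assume k: "k = 0 \<or> G k \<noteq> 0"
    show "\<exists>P. pressure_solution l r c \<mu> k P"
      using pressure_solution_exists[OF k] by blast
    fix P x assume P: "pressure_solution l r c \<mu> k P" and x: "x \<in> {0..l}"
    note P_eq = pressure_solution_unique[OF k P x]
    show "P x = - (\<i> * k * of_real c * of_real \<mu> / (of_real pi * of_real (r 0) * of_real (r x)))
             * (g k 0 / G k * \<phi> k x + S k x)"
      using P_eq unfolding pressure_def .
    show "P x = Q x" if "pressure_solution l r c \<mu> k Q" for Q
      using P_eq pressure_solution_unique[OF k that x] by simp
  qed
qed

end
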